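(* Let $(\Omega,g)$ be a 3-dimensional Riemannian manifold, with periodic or homogeneous boundary conditions, and let $c>0$ be a constant. Let $F,G$ be functionals of the fields $(\boldsymbol{D},\boldsymbol{B})$, regarded equivalently as functionals of $(\tilde{\boldsymbol{d}}^2,\boldsymbol{b}^2)$ through $\tilde{\boldsymbol{d}}^2=\mathbf{i}_{\boldsymbol{D}}\mathrm{vol}^3$ and $\boldsymbol{b}^2=\mathbf{i}_{\boldsymbol{B}}\mathrm{vol}^3$. Then the Poisson bracket of the exterior calculus formulation equals that of the vector calculus formulation: $$4\pi c\left[\left\langle\frac{\tilde\delta F}{\delta\tilde{\boldsymbol{d}}^2},\mathsf{d}\frac{\tilde\delta G}{\delta\boldsymbol{b}^2}\right\rangle-\left\langle\frac{\tilde\delta G}{\delta\tilde{\boldsymbol{d}}^2},\mathsf{d}\frac{\tilde\delta F}{\delta\boldsymbol{b}^2}\right\rangle\right]=4\pi c\int_\Omega\left[\frac{\delta F}{\delta\boldsymbol{D}}\cdot\nabla\times\frac{\delta G}{\delta\boldsymbol{B}}-\frac{\delta G}{\delta\boldsymbol{D}}\cdot\nabla\times\frac{\delta F}{\delta\boldsymbol{B}}\right]\mathrm{vol}^3 .$$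
   Context: $\Lambda^k$ denotes straight differential $k$-forms and $\tilde\Lambda^k$ twisted $k$-forms (which additionally change sign under orientation-reversing coordinate changes); $\mathsf{d}$ is the exterior derivative; the volume form $\mathrm{vol}^3$ is twisted, and integrals of twisted 3-forms are orientation independent. $\boldsymbol{D}$ is a vector field, so $\tilde{\boldsymbol{d}}^2\in\tilde\Lambda^2$; $\boldsymbol{B}$ is a pseudovector field (its sign depends on orientation), so $\boldsymbol{b}^2\in\Lambda^2$ is straight. Pairing: $\langle\omega^k,\tilde\eta^{3-k}\rangle=\int_\Omega\omega^k\wedge\tilde\eta^{3-k}$ for a straight $k$-form and a twisted $(3-k)$-form. Functional derivatives: $\frac{\tilde\delta F}{\delta\tilde{\boldsymbol{d}}^2}\in\Lambda^1$ and $\frac{\tilde\delta F}{\delta\boldsymbol{b}^2}\in\tilde\Lambda^1$ are defined by $$DF[\tilde{\boldsymbol{d}}^2,\boldsymbol{b}^2](\delta\tilde{\boldsymbol{d}}^2,\delta\boldsymbol{b}^2)=\int_\Omega\frac{\tilde\delta F}{\delta\tilde{\boldsymbol{d}}^2}\wedge\delta\tilde{\boldsymbol{d}}^2+\int_\Omega\delta\boldsymbol{b}^2\wedge\frac{\tilde\delta F}{\delta\boldsymbol{b}^2},$$ and $\frac{\delta F}{\delta\boldsymbol{D}},\frac{\delta F}{\delta\boldsymbol{B}}$ are the vector fields with $DF(\delta\boldsymbol{D},\delta\boldsymbol{B})=\int_\Omega(\frac{\delta F}{\delta\boldsymbol{D}}\cdot\delta\boldsymbol{D}+\frac{\delta F}{\delta\boldsymbol{B}}\cdot\delta\boldsymbol{B})\,\mathrm{vol}^3$.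 Here $U\cdot V=g(U,V)$, $V^\flat=g(\cdot,V)$, $\mathbf{i}_V$ is the interior product, and the curl is defined by $\mathsf{d}(V^\flat)=\mathbf{i}_{\nabla\times V}\mathrm{vol}^3$. Functionals are assumed differentiable with sufficiently regular functional derivatives. *)

theory Defs
  imports "HOL-Analysis.Analysis" "HOL-Combinatorics.Permutations"
begin

section \<open>Smooth functions on relatively open subsets of a half-space\<close>

text \<open>Derivatives are taken within \<open>S\<close>, hence are one-sided at boundary points of a half-space.\<close>

primrec Ck_on :: "nat \<Rightarrow> (real^3) set \<Rightarrow> (real^3 \<Rightarrow> real) \<Rightarrow> bool" where
  "Ck_on 0 S f \<longleftrightarrow> continuous_on S f"
| "Ck_on (Suc k) S f \<longleftrightarrow>
     (\<exists>f' :: real^3 \<Rightarrow> real^3.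
        (\<forall>x\<in>S. (f has_derivative (\<lambda>h. f' x \<bullet> h)) (at x within S)) \<and>
        (\<forall>i. Ck_on k S (\<lambda>x. f' x $ i)))"

definition smooth_on :: "(real^3) set \<Rightarrow> (real^3 \<Rightarrow> real) \<Rightarrow> bool" where
  "smooth_on S f \<longleftrightarrow> (\<forall>k. Ck_on k S f)"

definition half_space :: "(real^3) set" where
  "half_space = {x. 0 \<le> x $ 1}"

section \<open>Three-dimensional Riemannian manifolds, possibly with boundary\<close>

text \<open>A chart is a domain together with a coordinate map.  The metric is given by its matrix of
  components at each point in each chart.\<close>

type_synonym 'a chart = "'a set \<times> ('a \<Rightarrow> real^3)"

abbreviation cdom :: "'a chart \<Rightarrow> 'a set" where "cdom \<kappa> \<equiv> fst \<kappa>"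
abbreviation cmap :: "'a chart \<Rightarrow> 'a \<Rightarrow> real^3" where "cmap \<kappa> \<equiv> snd \<kappa>"
abbreviation cimg :: "'a chart \<Rightarrow> (real^3) set" where "cimg \<kappa> \<equiv> snd \<kappa> ` fst \<kappa>"

definition cinv :: "'a chart \<Rightarrow> real^3 \<Rightarrow> 'a" where
  "cinv \<kappa> = the_inv_into (cdom \<kappa>) (cmap \<kappa>)"

record 'a riemann3 =
  points :: "'a set"
  atlas :: "'a chart set"
  metric :: "'a chart \<Rightarrow> 'a \<Rightarrow> real^3^3"

definition is_chart :: "'a::topological_space set \<Rightarrow> 'a chart \<Rightarrow> bool" where
  "is_chart \<Omega> \<kappa> \<longleftrightarrow>
     openin (top_of_set \<Omega>) (cdom \<kappa>) \<and>
     (open (cimg \<kappa>) \<or> openin (top_of_set half_space) (cimg \<kappa>)) \<and>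
     inj_on (cmap \<kappa>) (cdom \<kappa>) \<and>
     homeomorphism (cdom \<kappa>) (cimg \<kappa>) (cmap \<kappa>) (cinv \<kappa>)"

definition jacobian :: "'a chart \<Rightarrow> 'a chart \<Rightarrow> 'a \<Rightarrow> real^3^3" where
  "jacobian \<kappa> \<kappa>' p =
     matrix (frechet_derivative (\<lambda>x. cmap \<kappa>' (cinv \<kappa> x))
       (at (cmap \<kappa> p) within cmap \<kappa> ` (cdom \<kappa> \<inter> cdom \<kappa>')))"

definition riemannian_3_manifold ::
    "'a::{t2_space, second_countable_topology} riemann3 \<Rightarrow> bool" where
  "riemannian_3_manifold M \<longleftrightarrow>
     (\<forall>\<kappa>\<in>atlas M. is_chart (points M) \<kappa>) \<and>
     \<Union> (cdom ` atlas M) = points M \<and>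
     (\<forall>\<kappa>\<in>atlas M. \<forall>\<kappa>'\<in>atlas M. \<forall>i.
        smooth_on (cmap \<kappa> ` (cdom \<kappa> \<inter> cdom \<kappa>')) (\<lambda>x. cmap \<kappa>' (cinv \<kappa> x) $ i)) \<and>
     (\<forall>\<kappa>\<in>atlas M. \<forall>i j. smooth_on (cimg \<kappa>) (\<lambda>x. metric M \<kappa> (cinv \<kappa> x) $ i $ j)) \<and>
     (\<forall>\<kappa>\<in>atlas M. \<forall>p\<in>cdom \<kappa>.
        transpose (metric M \<kappa> p) = metric M \<kappa> p \<and>
        (\<forall>u. u \<noteq> 0 \<longrightarrow> u \<bullet> (metric M \<kappa> p *v u) > 0)) \<and>
     (\<forall>\<kappa>\<in>atlas M. \<forall>\<kappa>'\<in>atlas M. \<forall>p\<in>cdom \<kappa> \<inter> cdom \<kappa>'.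
        metric M \<kappa> p = transpose (jacobian \<kappa> \<kappa>' p) ** metric M \<kappa>' p ** jacobian \<kappa> \<kappa>' p)"

definition interior_points :: "'a riemann3 \<Rightarrow> 'a set" where
  "interior_points M =
     {p \<in> points M. \<exists>\<kappa>\<in>atlas M. p \<in> cdom \<kappa> \<and> cmap \<kappa> p \<in> interior (cimg \<kappa>)}"

definition boundary_points :: "'a riemann3 \<Rightarrow> 'a set" where
  "boundary_points M = points M - interior_points M"

section \<open>Straight and twisted fields and forms\<close>

text \<open>Fields and forms are families of components, one for each chart, subject to the
  transformation law; a twisted object acquires in addition the sign of the Jacobian determinant.
  A twisted vector field is a pseudovector field.  Components are required to vanish where they
  have no meaning, so that equal fields are equal families.\<close>

datatype parity = Straight | Twisted

definition orientation_factor :: "parity \<Rightarrow> real^3^3 \<Rightarrow> real" where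
  "orientation_factor \<tau> J = (case \<tau> of Straight \<Rightarrow> 1 | Twisted \<Rightarrow> sgn (det J))"

type_synonym 'a vfield = "'a chart \<Rightarrow> 'a \<Rightarrow> real^3"
type_synonym 'a scalar = "'a chart \<Rightarrow> 'a \<Rightarrow> real"

text \<open>A \<open>k\<close>-form takes a sequence of tangent vectors, of which only the first \<open>k\<close> entries matter.\<close>

type_synonym 'a dform = "'a chart \<Rightarrow> 'a \<Rightarrow> (nat \<Rightarrow> real^3) \<Rightarrow> real"

definition vector_fields :: "'a riemann3 \<Rightarrow> parity \<Rightarrow> 'a vfield set" where
  "vector_fields M \<tau> = {V.
     (\<forall>\<kappa> p. \<not> (\<kappa> \<in> atlas M \<and> p \<in> cdom \<kappa>) \<longrightarrow> V \<kappa> p = 0) \<and>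
     (\<forall>\<kappa>\<in>atlas M. \<forall>i. smooth_on (cimg \<kappa>) (\<lambda>x. V \<kappa> (cinv \<kappa> x) $ i)) \<and>
     (\<forall>\<kappa>\<in>atlas M. \<forall>\<kappa>'\<in>atlas M. \<forall>p\<in>cdom \<kappa> \<inter> cdom \<kappa>'.
        V \<kappa>' p = orientation_factor \<tau> (jacobian \<kappa> \<kappa>' p) *\<^sub>R (jacobian \<kappa> \<kappa>' p *v V \<kappa> p))}"

definition alternating_multilinear :: "nat \<Rightarrow> ((nat \<Rightarrow> real^3) \<Rightarrow> real) \<Rightarrow> bool" where
  "alternating_multilinear k \<alpha> \<longleftrightarrow>
     (\<forall>v w. (\<forall>i<k. v i = w i) \<longrightarrow> \<alpha> v = \<alpha> w) \<and>
     (\<forall>i<k. \<forall>v. linear (\<lambda>u. \<alpha> (v(i := u)))) \<and>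
     (\<forall>v i j. i < k \<and> j < k \<and> i \<noteq> j \<and> v i = v j \<longrightarrow> \<alpha> v = 0)"

definition diff_forms :: "'a riemann3 \<Rightarrow> parity \<Rightarrow> nat \<Rightarrow> 'a dform set" where
  "diff_forms M \<tau> k = {\<omega>.
     (\<forall>\<kappa> p v. \<not> (\<kappa> \<in> atlas M \<and> p \<in> cdom \<kappa>) \<longrightarrow> \<omega> \<kappa> p v = 0) \<and>
     (\<forall>\<kappa>\<in>atlas M. \<forall>p\<in>cdom \<kappa>. alternating_multilinear k (\<omega> \<kappa> p)) \<and>
     (\<forall>\<kappa>\<in>atlas M. \<forall>v. smooth_on (cimg \<kappa>) (\<lambda>x. \<omega> \<kappa> (cinv \<kappa> x) v)) \<and>
     (\<forall>\<kappa>\<in>atlas M. \<forall>\<kappa>'\<in>atlas M. \<forall>p\<in>cdom \<kappa> \<inter> cdom \<kappa>'. \<forall>v.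
        \<omega> \<kappa> p v = orientation_factor \<tau> (jacobian \<kappa> \<kappa>' p) *
                    \<omega> \<kappa>' p (\<lambda>i. jacobian \<kappa> \<kappa>' p *v v i))}"

section \<open>Exterior calculus\<close>

definition wedge :: "nat \<Rightarrow> nat \<Rightarrow> 'a dform \<Rightarrow> 'a dform \<Rightarrow> 'a dform" where
  "wedge k l \<omega> \<eta> = (\<lambda>\<kappa> p v.
     (\<Sum>\<sigma> | \<sigma> permutes {..<k + l}.
        of_int (sign \<sigma>) * \<omega> \<kappa> p (\<lambda>i. v (\<sigma> i)) * \<eta> \<kappa> p (\<lambda>i. v (\<sigma> (k + i))))
     / (fact k * fact l))"

definition omit :: "nat \<Rightarrow> (nat \<Rightarrow> 'b) \<Rightarrow> nat \<Rightarrow> 'b" where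
  "omit i v = (\<lambda>j. if j < i then v j else v (Suc j))"

definition ext_deriv :: "nat \<Rightarrow> 'a dform \<Rightarrow> 'a dform" where
  "ext_deriv k \<omega> = (\<lambda>\<kappa> p v.
     \<Sum>i\<le>k. (-1) ^ i *
       frechet_derivative (\<lambda>x. \<omega> \<kappa> (cinv \<kappa> x) (omit i v)) (at (cmap \<kappa> p) within cimg \<kappa>) (v i))"

definition int_prod :: "'a vfield \<Rightarrow> 'a dform \<Rightarrow> 'a dform" where
  "int_prod V \<omega> = (\<lambda>\<kappa> p v. \<omega> \<kappa> p (case_nat (V \<kappa> p) v))"

definition g_inner :: "'a riemann3 \<Rightarrow> 'a vfield \<Rightarrow> 'a vfield \<Rightarrow> 'a scalar" where
  "g_inner M U V = (\<lambda>\<kappa> p. U \<kappa> p \<bullet> (metric M \<kappa> p *v V \<kappa> p))"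

definition flat :: "'a riemann3 \<Rightarrow> 'a vfield \<Rightarrow> 'a dform" where
  "flat M V = (\<lambda>\<kappa> p v. v 0 \<bullet> (metric M \<kappa> p *v V \<kappa> p))"

definition vol :: "'a riemann3 \<Rightarrow> 'a dform" where
  "vol M = (\<lambda>\<kappa> p v. sqrt (det (metric M \<kappa> p)) * det (vector [v 0, v 1, v 2] :: real^3^3))"

definition vol_density :: "'a riemann3 \<Rightarrow> 'a scalar \<Rightarrow> 'a dform" where
  "vol_density M f = (\<lambda>\<kappa> p v. f \<kappa> p * vol M \<kappa> p v)"

text \<open>The equation determines \<open>C\<close> on the chart domains, as \<open>vol\<close> is nondegenerate there.\<close>

definition curl :: "'a riemann3 \<Rightarrow> 'a vfield \<Rightarrow> 'a vfield" where
  "curl M V = (SOME C. \<forall>\<kappa>\<in>atlas M. \<forall>p\<in>cdom \<kappa>.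
     ext_deriv 1 (flat M V) \<kappa> p = int_prod C (vol M) \<kappa> p)"

section \<open>Integration of twisted 3-forms\<close>

text \<open>The manifold is cut into countably many disjoint Borel pieces, each inside a chart domain.
  Components of a twisted 3-form transform with the absolute value of the Jacobian determinant,
  so by the change of variables formula the integral depends neither on the choice of such a
  partition nor on orientations.\<close>

definition chart_partition ::
    "'a riemann3 \<Rightarrow> (nat \<Rightarrow> 'a chart) \<Rightarrow> (nat \<Rightarrow> 'a set) \<Rightarrow> bool" where
  "chart_partition M K A \<longleftrightarrow>
     (\<forall>n. A n = {} \<or> K n \<in> atlas M \<and> A n \<subseteq> cdom (K n)) \<and>
     (\<forall>n. cmap (K n) ` A n \<in> sets borel) \<and>
     disjoint_family A \<and> (\<Union>n. A n) = points M"

definition some_partition :: "'a riemann3 \<Rightarrow> (nat \<Rightarrow> 'a chart) \<times> (nat \<Rightarrow> 'a set)" where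
  "some_partition M = (SOME (K, A). chart_partition M K A)"

definition coordinate_frame :: "nat \<Rightarrow> real^3" where
  "coordinate_frame = (!) [axis 1 1, axis 2 1, axis 3 1]"

definition piece :: "'a riemann3 \<Rightarrow> nat \<Rightarrow> (real^3) set" where
  "piece M n = (case some_partition M of (K, A) \<Rightarrow> cmap (K n) ` A n)"

definition local_density :: "'a riemann3 \<Rightarrow> 'a dform \<Rightarrow> nat \<Rightarrow> real^3 \<Rightarrow> real" where
  "local_density M \<omega> n x =
     (case some_partition M of (K, A) \<Rightarrow> \<omega> (K n) (cinv (K n) x) coordinate_frame)"

definition form_integrable :: "'a riemann3 \<Rightarrow> 'a dform \<Rightarrow> bool" where
  "form_integrable M \<omega> \<longleftrightarrow>
     (\<forall>n. set_integrable lborel (piece M n) (local_density M \<omega> n)) \<and>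
     summable (\<lambda>n. LINT x:piece M n|lborel. \<bar>local_density M \<omega> n x\<bar>)"

definition form_integral :: "'a riemann3 \<Rightarrow> 'a dform \<Rightarrow> real" where
  "form_integral M \<omega> = (\<Sum>n. LINT x:piece M n|lborel. local_density M \<omega> n x)"

definition pairing :: "'a riemann3 \<Rightarrow> nat \<Rightarrow> 'a dform \<Rightarrow> 'a dform \<Rightarrow> real" where
  "pairing M k \<omega> \<eta> = form_integral M (wedge k (3 - k) \<omega> \<eta>)"

section \<open>Boundary conditions\<close>

definition field_pairs :: "'a riemann3 \<Rightarrow> ('a vfield \<times> 'a vfield) set" where
  "field_pairs M = vector_fields M Straight \<times> vector_fields M Twisted"

definition periodic_bc ::
    "'a::topological_space riemann3 \<Rightarrow> ('a vfield \<times> 'a vfield) set \<Rightarrow> bool" where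
  "periodic_bc M \<V> \<longleftrightarrow>
     compact (points M) \<and> boundary_points M = {} \<and> \<V> = field_pairs M"

text \<open>Homogeneous boundary conditions: a linear space of fields, membership in which depends only
  on the behaviour of the fields near the boundary (and near infinity, if the manifold is not
  compact).  Examples are the vanishing of all, of the tangential or of the normal components on
  the boundary.\<close>

definition homogeneous_bc ::
    "'a::topological_space riemann3 \<Rightarrow> ('a vfield \<times> 'a vfield) set \<Rightarrow> bool" where
  "homogeneous_bc M \<V> \<longleftrightarrow>
     \<V> \<subseteq> field_pairs M \<and>
     ((\<lambda>\<kappa> p. 0), (\<lambda>\<kappa> p. 0)) \<in> \<V> \<and>
     (\<forall>(D, B)\<in>\<V>. \<forall>(D', B')\<in>\<V>. \<forall>a b :: real.
        ((\<lambda>\<kappa> p. a *\<^sub>R D \<kappa> p + b *\<^sub>R D' \<kappa> p), (\<lambda>\<kappa> p. a *\<^sub>R B \<kappa> p + b *\<^sub>R B' \<kappa> p)) \<in> \<V>) \<and>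
     (\<forall>(D, B)\<in>\<V>. \<forall>(D', B')\<in>field_pairs M.
        (\<exists>K. compact K \<and> K \<subseteq> interior_points M \<and>
           (\<forall>\<kappa> p. p \<notin> K \<longrightarrow> D' \<kappa> p = D \<kappa> p \<and> B' \<kappa> p = B \<kappa> p))
        \<longrightarrow> (D', B') \<in> \<V>)"

section \<open>Functional derivatives\<close>

text \<open>The derivative of a functional at a state is the directional derivative along all admissible
  variations, here in each of the two formulations.\<close>

definition has_vector_fderivs ::
    "'a riemann3 \<Rightarrow> ('a vfield \<times> 'a vfield) set \<Rightarrow> ('a vfield \<Rightarrow> 'a vfield \<Rightarrow> real) \<Rightarrow>
     'a vfield \<Rightarrow> 'a vfield \<Rightarrow> 'a vfield \<Rightarrow> 'a vfield \<Rightarrow> bool" where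
  "has_vector_fderivs M \<V> F D B F\<^sub>D F\<^sub>B \<longleftrightarrow>
     F\<^sub>D \<in> vector_fields M Straight \<and> F\<^sub>B \<in> vector_fields M Twisted \<and>
     (\<forall>(\<delta>D, \<delta>B)\<in>\<V>.
        let \<omega> = vol_density M (\<lambda>\<kappa> p. g_inner M F\<^sub>D \<delta>D \<kappa> p + g_inner M F\<^sub>B \<delta>B \<kappa> p) in
        form_integrable M \<omega> \<and>
        ((\<lambda>\<epsilon>. F (\<lambda>\<kappa> p. D \<kappa> p + \<epsilon> *\<^sub>R \<delta>D \<kappa> p) (\<lambda>\<kappa> p. B \<kappa> p + \<epsilon> *\<^sub>R \<delta>B \<kappa> p))
           has_real_derivative form_integral M \<omega>) (at 0))"

text \<open>Admissible variations of the 2-forms correspond to those of the vector fields.\<close>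

definition has_form_fderivs ::
    "'a riemann3 \<Rightarrow> ('a vfield \<times> 'a vfield) set \<Rightarrow> ('a dform \<Rightarrow> 'a dform \<Rightarrow> real) \<Rightarrow>
     'a dform \<Rightarrow> 'a dform \<Rightarrow> 'a dform \<Rightarrow> 'a dform \<Rightarrow> bool" where
  "has_form_fderivs M \<V> F d b F\<^sub>d F\<^sub>b \<longleftrightarrow>
     F\<^sub>d \<in> diff_forms M Straight 1 \<and> F\<^sub>b \<in> diff_forms M Twisted 1 \<and>
     (\<forall>(\<delta>d, \<delta>b)\<in>(\<lambda>(\<delta>D, \<delta>B). (int_prod \<delta>D (vol M), int_prod \<delta>B (vol M))) ` \<V>.
        form_integrable M (wedge 1 2 F\<^sub>d \<delta>d) \<and> form_integrable M (wedge 2 1 \<delta>b F\<^sub>b) \<and>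
        ((\<lambda>\<epsilon>. F (\<lambda>\<kappa> p v. d \<kappa> p v + \<epsilon> * \<delta>d \<kappa> p v) (\<lambda>\<kappa> p v. b \<kappa> p v + \<epsilon> * \<delta>b \<kappa> p v))
           has_real_derivative
             form_integral M (wedge 1 2 F\<^sub>d \<delta>d) + form_integral M (wedge 2 1 \<delta>b F\<^sub>b)) (at 0))"

end

theory Submission
  imports Defs
begin

text \<open>Both formulations compute the same directional derivatives, and pointwise
  \<open>\<alpha> \<and> i\<^sub>V vol = \<alpha>(V) vol = i\<^sub>V vol \<and> \<alpha>\<close> for a \<open>1\<close>-form \<open>\<alpha>\<close>.  Testing with variations supported in a
  small coordinate ball, the fundamental lemma of the calculus of variations identifies the
  functional derivatives of the form formulation with the flats of those of the vector formulation,
  first in the interior and then, by continuity, on the boundary.  The defining property of the curl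
  then makes the integrands of the two brackets agree pointwise; no integration by parts is needed,
  so the boundary conditions only matter for the supply of variations.\<close>

section \<open>Calculus of smooth functions\<close>

text \<open>The difficulty lies in the variations. A test field must be given in every chart of the
  atlas, smooth up to the boundary and of the right parity, so a bump known in a single chart has to
  be carried to all others by Jacobians and orientation signs and then continued by zero. This rests
  on the smoothness and the cocycle law of the Jacobians, on local constancy of the sign, and on
  closedness of compact sets, which is where the Hausdorff property enters. Since
  \<open>Ck_on\<close> asserts only that some gradient exists, identities between derivatives come
  from their uniqueness within relatively open pieces of a half-space. The integral is tied to one
  partition chosen by \<open>SOME\<close>. The proof never changes variables under it: the test
  field is adapted to the covector so that the integrand is nonnegative, and a vanishing integral
  then leaves only null sets to be moved between charts. The two fields are separated by varying one
  while the other stays fixed, and the parity is a parameter, so that one argument serves straight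
  and twisted objects.\<close>

lemma Ck_on_cong:
  assumes "Ck_on k S f" "\<And>x. x \<in> S \<Longrightarrow> f x = g x"
  shows "Ck_on k S g"
proof (cases k)
  case 0
  with assms show ?thesis using continuous_on_cong by auto
next
  case (Suc m)
  then obtain f' where f': "\<And>x. x \<in> S \<Longrightarrow> (f has_derivative (\<lambda>h. f' x \<bullet> h)) (at x within S)"
    and C: "\<And>i. Ck_on m S (\<lambda>x. f' x $ i)"
    using assms(1) by auto
  have "(g has_derivative (\<lambda>h. f' x \<bullet> h)) (at x within S)" if "x \<in> S" for x
    by (rule has_derivative_transform[OF that _ f'[OF that]]) (simp add: assms(2))
  with C Suc show ?thesis by auto
qed

lemma Ck_on_continuous: "Ck_on k S f \<Longrightarrow> continuous_on S f"
  by (cases k) (auto simp: continuous_on_eq_continuous_within intro: has_derivative_continuous)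

lemma Ck_on_const: "Ck_on k S (\<lambda>x. c)"
proof (induction k arbitrary: c)
  case (Suc k)
  show ?case
    by (simp, rule exI[of _ "\<lambda>x. 0"]) (simp add: Suc)
qed auto

lemma Ck_on_Suc_imp: "Ck_on (Suc k) S f \<Longrightarrow> Ck_on k S f"
proof (induction k arbitrary: f)
  case 0
  then show ?case using Ck_on_continuous by (simp only: Ck_on.simps(1))
next
  case (Suc k)
  then obtain f' where "\<forall>x\<in>S. (f has_derivative (\<lambda>h. f' x \<bullet> h)) (at x within S)"
    and "\<forall>i. Ck_on (Suc k) S (\<lambda>x. f' x $ i)"
    by (auto simp only: Ck_on.simps(2)[of "Suc k"])
  with Suc.IH show ?case by (auto simp only: Ck_on.simps(2)[of k])
qed

lemma Ck_on_add: "Ck_on k S f \<Longrightarrow> Ck_on k S g \<Longrightarrow> Ck_on k S (\<lambda>x. f x + g x)"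
proof (induction k arbitrary: f g)
  case 0
  then show ?case by (simp add: continuous_on_add)
next
  case (Suc k)
  obtain f' where f': "\<forall>x\<in>S. (f has_derivative (\<lambda>h. f' x \<bullet> h)) (at x within S)"
    "\<forall>i. Ck_on k S (\<lambda>x. f' x $ i)" using Suc.prems by auto
  obtain g' where g': "\<forall>x\<in>S. (g has_derivative (\<lambda>h. g' x \<bullet> h)) (at x within S)"
    "\<forall>i. Ck_on k S (\<lambda>x. g' x $ i)" using Suc.prems by auto
  show ?case
    using f' g' Suc.IH
    by (simp, intro exI[of _ "\<lambda>x. f' x + g' x"])
       (auto simp: inner_add_left intro!: has_derivative_add)
qed

lemma Ck_on_mult: "Ck_on k S f \<Longrightarrow> Ck_on k S g \<Longrightarrow> Ck_on k S (\<lambda>x. f x * g x)"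
proof (induction k arbitrary: f g)
  case 0
  then show ?case by (simp add: continuous_on_mult)
next
  case (Suc k)
  obtain f' where f': "\<forall>x\<in>S. (f has_derivative (\<lambda>h. f' x \<bullet> h)) (at x within S)"
    "\<forall>i. Ck_on k S (\<lambda>x. f' x $ i)" using Suc.prems by auto
  obtain g' where g': "\<forall>x\<in>S. (g has_derivative (\<lambda>h. g' x \<bullet> h)) (at x within S)"
    "\<forall>i. Ck_on k S (\<lambda>x. g' x $ i)" using Suc.prems by auto
  have 1: "Ck_on k S f" "Ck_on k S g" using Suc.prems Ck_on_Suc_imp by blast+
  have "((\<lambda>x. f x * g x) has_derivative (\<lambda>h. (f x *\<^sub>R g' x + g x *\<^sub>R f' x) \<bullet> h)) (at x within S)"
    if "x \<in> S" for x
    by (rule has_derivative_eq_rhs[OF has_derivative_mult[OF f'(1)[rule_format, OF that]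
          g'(1)[rule_format, OF that]]]) (auto simp: inner_add_left)
  moreover have "Ck_on k S (\<lambda>x. f x * g' x $ i + g x * f' x $ i)" for i
    using 1 f'(2) g'(2) Suc.IH Ck_on_add by auto
  ultimately show ?case
    by (simp, intro exI[of _ "\<lambda>x. f x *\<^sub>R g' x + g x *\<^sub>R f' x"]) auto
qed

lemma Ck_on_sum: "(\<And>i. i \<in> I \<Longrightarrow> Ck_on k S (f i)) \<Longrightarrow> Ck_on k S (\<lambda>x. \<Sum>i\<in>I. f i x)"
  by (induction I rule: infinite_finite_induct) (auto intro: Ck_on_const Ck_on_add)

lemma Ck_on_component: "Ck_on k S (\<lambda>x. x $ i)"
proof (cases k)
  case 0
  then show ?thesis by (simp add: continuous_intros)
next
  case (Suc m)
  have "((\<lambda>x. x $ i) has_derivative (\<lambda>h. axis i 1 \<bullet> h)) (at x within S)" for x :: "real^3"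
    by (simp add: inner_axis') (rule bounded_linear_imp_has_derivative[OF bounded_linear_vec_nth])
  then show ?thesis
    using Suc by (auto intro!: exI[of _ "\<lambda>x. axis i 1"] Ck_on_const)
qed

lemma has_derivative_vec_componentwise:
  fixes f :: "real^'m \<Rightarrow> real^'n"
  assumes "\<And>i. ((\<lambda>x. f x $ i) has_derivative (\<lambda>h. f' i \<bullet> h)) (at x within S)"
  shows "(f has_derivative (\<lambda>h. \<chi> i. f' i \<bullet> h)) (at x within S)"
  unfolding has_derivative_componentwise_within[of f]
proof
  fix b :: "real^'n" assume "b \<in> Basis"
  then obtain i where "b = axis i 1" by (auto simp: Basis_vec_def)
  then show "((\<lambda>x. f x \<bullet> b) has_derivative (\<lambda>x. (\<chi> i. f' i \<bullet> x) \<bullet> b)) (at x within S)"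
    using assms[of i] by (simp add: inner_axis)
qed

lemma Ck_on_compose:
  fixes g :: "real^3 \<Rightarrow> real^3"
  assumes "Ck_on k T f" "\<And>i. Ck_on k S (\<lambda>x. g x $ i)" "g ` S \<subseteq> T"
  shows "Ck_on k S (\<lambda>x. f (g x))"
  using assms
proof (induction k arbitrary: f)
  case 0
  have "continuous_on S g"
    using 0(2) continuous_on_vec_lambda[of S "\<lambda>i x. g x $ i"] by simp
  with 0 show ?case by (auto intro: continuous_on_compose2)
next
  case (Suc k)
  obtain f' where f': "\<forall>x\<in>T. (f has_derivative (\<lambda>h. f' x \<bullet> h)) (at x within T)"
    "\<forall>i. Ck_on k T (\<lambda>x. f' x $ i)" using Suc.prems by auto
  have "\<forall>i. \<exists>g'. (\<forall>x\<in>S. ((\<lambda>x. g x $ i) has_derivative (\<lambda>h. g' x \<bullet> h)) (at x within S)) \<and>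
    (\<forall>j. Ck_on k S (\<lambda>x. g' x $ j))" using Suc.prems by auto
  then obtain g' where g': "\<And>i x. x\<in>S \<Longrightarrow> ((\<lambda>x. g x $ i) has_derivative (\<lambda>h. g' i x \<bullet> h)) (at x within S)"
    "\<And>i j. Ck_on k S (\<lambda>x. g' i x $ j)" by metis
  \<comment> \<open>The chain rule in gradient form: the gradients of the components of
    \<open>g\<close>, weighted by the partial derivatives of \<open>f\<close> at \<open>g x\<close>.
    Only sums and products of functions of class \<open>k\<close> occur in it.\<close>
  let ?d = "\<lambda>x. \<Sum>i\<in>UNIV. (f' (g x) $ i) *\<^sub>R g' i x"
  have "((\<lambda>x. f (g x)) has_derivative (\<lambda>h. ?d x \<bullet> h)) (at x within S)" if "x \<in> S" for x
  proof (rule has_derivative_eq_rhs)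
    show "((\<lambda>x. f (g x)) has_derivative (\<lambda>h. f' (g x) \<bullet> (\<chi> i. g' i x \<bullet> h))) (at x within S)"
      by (rule has_derivative_in_compose2[OF _ _ that has_derivative_vec_componentwise, of T])
         (use f'(1) g'(1) that Suc.prems in auto)
    show "(\<lambda>h. f' (g x) \<bullet> (\<chi> i. g' i x \<bullet> h)) = (\<lambda>h. ?d x \<bullet> h)"
      by (simp add: inner_vec_def[of "f' (g x)"] inner_sum_left)
  qed
  moreover have "Ck_on k S (\<lambda>x. ?d x $ j)" for j
    using Suc.IH[OF f'(2)[rule_format] _ Suc.prems(3)] Suc.prems(2)[THEN Ck_on_Suc_imp] g'(2)
    by (auto intro!: Ck_on_sum Ck_on_mult)
  ultimately show ?case by (simp, intro exI[of _ ?d]) auto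
qed

lemma Ck_on_locally_constant:
  assumes "\<And>x. x \<in> S \<Longrightarrow> eventually (\<lambda>y. f y = f x) (at x within S)"
  shows "Ck_on k S f"
proof -
  have 1: "(f has_derivative (\<lambda>h. 0 \<bullet> h)) (at x within S)" if "x \<in> S" for x
  proof -
    have "((\<lambda>y. f x) has_derivative (\<lambda>h. 0 \<bullet> h)) (at x within S)" by simp
    then show ?thesis
      by (rule has_derivative_transform_eventually[OF _ _ _ that])
        (use assms[OF that] in \<open>auto elim: eventually_mono\<close>)
  qed
  show ?thesis
  proof (cases k)
    case 0
    have "continuous_on S f"
      unfolding continuous_on_eq_continuous_within using 1 has_derivative_continuous by blast
    with 0 show ?thesis by simp
  next
    case (Suc m)
    with 1 show ?thesis by (auto intro!: exI[of _ "\<lambda>x. 0"] Ck_on_const)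
  qed
qed

text \<open>Away from the zeros of \<open>f\<close> the sign is locally constant. This is how the
  orientation sign of a Jacobian becomes a smooth factor.\<close>

lemma Ck_on_sgn:
  assumes "continuous_on S f" "\<And>x. x \<in> S \<Longrightarrow> f x \<noteq> 0"
  shows "Ck_on k S (\<lambda>x. sgn (f x))"
proof (rule Ck_on_locally_constant)
  fix x assume x: "x \<in> S"
  have lim: "(f \<longlongrightarrow> f x) (at x within S)" using assms(1) x by (simp add: continuous_on_def)
  show "\<forall>\<^sub>F y in at x within S. sgn (f y) = sgn (f x)"
  proof (cases "f x > 0")
    case True
    show ?thesis using order_tendstoD(1)[OF lim True] by eventually_elim (use True in auto)
  next
    case False
    then have n: "f x < 0" using assms(2)[OF x] by simp
    show ?thesis using order_tendstoD(2)[OF lim n] by eventually_elim (use n in auto)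
  qed
qed

section \<open>Uniqueness of derivatives on relatively open sets\<close>

text \<open>The two kinds of chart image. The class is kept apart from \<open>is_chart\<close>
  because it passes to relatively open subsets such as overlaps, on which derivatives are also
  taken.\<close>

definition half_space_open :: "(real^3) set \<Rightarrow> bool" where
  "half_space_open S \<longleftrightarrow> open S \<or> openin (top_of_set half_space) S"

text \<open>A boundary point of the half-space has no full ball inside \<open>S\<close>, but the
  half ball on the side of larger first coordinate is available in both cases, so later arguments
  need not distinguish interior from boundary points.\<close>

lemma half_space_openE:
  assumes "half_space_open S" "x \<in> S"
  obtains e where "e > 0" "\<And>y. dist y x < e \<Longrightarrow> x $ 1 \<le> y $ 1 \<Longrightarrow> y \<in> S"
  using assms(1) unfolding half_space_open_def
proof
  assume "open S"
  then show ?thesis using assms(2) that by (auto simp: open_dist)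
next
  assume "openin (top_of_set half_space) S"
  then obtain T where T: "open T" "S = half_space \<inter> T" by (auto simp: openin_open)
  then obtain e where e: "e > 0" "\<forall>y. dist y x < e \<longrightarrow> y \<in> T" using assms(2) by (auto simp: open_dist)
  show ?thesis by (rule that[OF e(1)]) (use T e assms(2) in \<open>auto simp: half_space_def\<close>)
qed

lemma half_space_open_openin:
  assumes "half_space_open S" "openin (top_of_set S) T"
  shows "half_space_open T"
  using assms unfolding half_space_open_def by (metis openin_open_eq openin_trans)

text \<open>Small positive steps along every coordinate axis stay in \<open>S\<close>, as no basis
  vector has a negative first component, and these directions determine a linear map.\<close>

lemma half_space_open_derivative_unique:
  fixes f :: "real^3 \<Rightarrow> 'b::real_normed_vector"
  assumes "half_space_open S" "x \<in> S"
    and 1: "(f has_derivative f') (at x within S)" "(f has_derivative f'') (at x within S)"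
  shows "f' = f''"
proof (rule frechet_derivative_unique_within[OF 1])
  fix i :: "real^3" and e :: real assume i: "i \<in> Basis" and e: "e > 0"
  obtain r where r: "r > 0" "\<And>y. dist y x < r \<Longrightarrow> x $ 1 \<le> y $ 1 \<Longrightarrow> y \<in> S"
    using half_space_openE[OF assms(1,2)] by blast
  have "i $ 1 \<ge> 0" using i by (auto simp: Basis_vec_def axis_def)
  then have "x + (min e r / 2) *\<^sub>R i \<in> S"
    using i e r(1) by (intro r(2)) (auto simp: dist_norm)
  then show "\<exists>d. 0 < \<bar>d\<bar> \<and> \<bar>d\<bar> < e \<and> x + d *\<^sub>R i \<in> S"
    using e r(1) by (intro exI[of _ "min e r / 2"]) auto
qed

lemma at_within_openin:
  assumes "openin (top_of_set S) T" "x \<in> T"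
  shows "at x within T = at x within S"
proof -
  obtain U where "open U" "T = S \<inter> U" using assms(1) by (auto simp: openin_open)
  then show ?thesis using assms(2) by (intro at_within_nhd[of _ U]) auto
qed

lemma eventually_at_openin:
  assumes "openin (top_of_set S) T" "x \<in> T" "\<And>y. y \<in> T \<Longrightarrow> P y"
  shows "\<forall>\<^sub>F y in at x within S. P y"
  unfolding at_within_openin[OF assms(1,2), symmetric]
  using assms(3) by (auto simp: eventually_at_filter)

text \<open>\<open>S1\<close> and \<open>S - C\<close> form a relatively open cover of
  \<open>S\<close>, and the claim is local. The induction survives differentiation because on
  \<open>S1 - C\<close> uniqueness forces the gradient to vanish, so the gradient satisfies the
  hypotheses again.\<close>

lemma Ck_on_extend_zero:
  assumes "half_space_open S" "openin (top_of_set S) S1" "closedin (top_of_set S) C" "C \<subseteq> S1"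
    and "Ck_on k S1 f" "\<And>x. x \<in> S - C \<Longrightarrow> f x = 0"
  shows "Ck_on k S f"
proof -
  have op: "openin (top_of_set S) (S - C)" using assms(3) by (simp add: openin_diff)
  have zero: "(f has_derivative (\<lambda>h. 0 \<bullet> h)) (at x within S)"
    if "x \<in> S - C" "\<And>x. x \<in> S - C \<Longrightarrow> f x = 0" for x f
  proof (rule has_derivative_transform_eventually)
    show "((\<lambda>y. 0) has_derivative (\<lambda>h. 0 \<bullet> h)) (at x within S)" by simp
    show "\<forall>\<^sub>F y in at x within S. 0 = f y"
      by (rule eventually_at_openin[OF op]) (use that in auto)
  qed (use that in auto)
  have S1S: "S1 \<subseteq> S" using assms(2) openin_imp_subset by blast
  show ?thesis using assms(5,6)
  proof (induction k arbitrary: f)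
    case 0
    have "continuous (at x within S) f" if "x \<in> S" for x
    proof (cases "x \<in> C")
      case True
      then have x: "x \<in> S1" using assms(4) by auto
      then have "continuous (at x within S1) f" using 0 by (simp add: continuous_on_eq_continuous_within)
      then show ?thesis by (simp only: at_within_openin[OF assms(2) x])
    next
      case False
      then show ?thesis using zero[of x f] that 0(2) has_derivative_continuous by blast
    qed
    then show ?case by (simp add: continuous_on_eq_continuous_within)
  next
    case (Suc k)
    obtain f' where f': "\<forall>x\<in>S1. (f has_derivative (\<lambda>h. f' x \<bullet> h)) (at x within S1)"
      "\<forall>i. Ck_on k S1 (\<lambda>x. f' x $ i)" using Suc.prems by auto
    \<comment> \<open>The gradient obtained on \<open>S1\<close> has arbitrary values elsewhere;
      cutting it off outside \<open>C\<close> gives a gradient on all of \<open>S\<close> without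
      altering it on \<open>S1\<close>.\<close>
    define e where "e = (\<lambda>x. if x \<in> C then f' x else 0)"
    have "f' x = 0" if x: "x \<in> S1 - C" for x
    proof -
      have "(f has_derivative (\<lambda>h. f' x \<bullet> h)) (at x within S)"
        using x f'(1) at_within_openin[OF assms(2), of x] by auto
      from half_space_open_derivative_unique[OF assms(1) _ this zero[of x f]]
      have "(\<lambda>h. f' x \<bullet> h) = (\<lambda>h. 0 \<bullet> h)" using x S1S Suc.prems by auto
      then show ?thesis by (metis inner_eq_zero_iff inner_zero_left)
    qed
    then have e1: "f' x = e x" if "x \<in> S1" for x using that by (auto simp: e_def)
    have "Ck_on k S (\<lambda>x. e x $ i)" for i
    proof (rule Suc.IH)
      show "Ck_on k S1 (\<lambda>x. e x $ i)" by (rule Ck_on_cong[OF f'(2)[rule_format]]) (simp add: e1)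
    qed (simp add: e_def)
    moreover have "(f has_derivative (\<lambda>h. e x \<bullet> h)) (at x within S)" if "x \<in> S" for x
    proof (cases "x \<in> C")
      case True
      then have x: "x \<in> S1" using assms(4) by auto
      then show ?thesis using f'(1) at_within_openin[OF assms(2) x] e1[OF x] by auto
    next
      case False
      then show ?thesis using zero[of x f] that Suc.prems(2) by (auto simp: e_def)
    qed
    ultimately show ?case by auto
  qed
qed

section \<open>A smooth bump function\<close>

text \<open>The family is closed under differentiation up to linear combinations, so its smoothness is a
  single induction over all \<open>n\<close>.\<close>

definition flat_exp :: "nat \<Rightarrow> real \<Rightarrow> real" where
  "flat_exp n t = (if t > 0 then inverse t ^ n * exp (- inverse t) else 0)"

text \<open>With \<open>s = inverse t\<close> this is the decay of \<open>s ^ n / exp s\<close> at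
  infinity; from the left the function is zero.\<close>

lemma flat_exp_lim: "(flat_exp n \<longlongrightarrow> 0) (at 0)"
  unfolding filterlim_split_at
proof -
  have "((\<lambda>s::real. s ^ n / exp s) \<longlongrightarrow> 0) at_top" by (rule tendsto_power_div_exp_0)
  then have "((\<lambda>t::real. inverse t ^ n / exp (inverse t)) \<longlongrightarrow> 0) (at_right 0)"
    by (rule filterlim_compose[OF _ filterlim_inverse_at_top_right])
  then have "(flat_exp n \<longlongrightarrow> 0) (at_right 0)"
    by (rule Lim_transform_eventually)
       (auto simp: eventually_at_filter flat_exp_def exp_minus field_simps)
  moreover have "(flat_exp n \<longlongrightarrow> 0) (at_left 0)"
    by (rule Lim_transform_eventually[OF tendsto_const]) (auto simp: eventually_at_filter flat_exp_def)
  ultimately show "(flat_exp n \<longlongrightarrow> 0) (at 0)" by (simp add: filterlim_split_at)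
qed

lemma flat_exp_deriv:
  "(flat_exp n has_real_derivative (flat_exp (n + 2) t - real n * flat_exp (n + 1) t)) (at t)"
proof -
  consider "t > 0" | "t < 0" | "t = 0" by linarith
  then show ?thesis
  proof cases
    case 1
    have "((\<lambda>t. inverse t ^ n * exp (- inverse t)) has_real_derivative
      (flat_exp (n + 2) t - real n * flat_exp (n + 1) t)) (at t)"
    proof -
      have i: "(inverse has_real_derivative - (inverse t * inverse t)) (at t)"
        using DERIV_inverse[of t UNIV] 1 by (simp add: power2_eq_square)
      show ?thesis
        by (rule DERIV_cong[OF DERIV_mult[OF DERIV_power[OF i, of n]
              DERIV_chain2[OF DERIV_exp DERIV_minus[OF i]]]])
           (use 1 in \<open>cases n; simp add: flat_exp_def algebra_simps\<close>)
    qed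
    then show ?thesis
      by (rule has_field_derivative_transform_within_open[where S="{0<..}"]) (use 1 in \<open>auto simp: flat_exp_def\<close>)
  next
    case 2
    have "((\<lambda>t. 0) has_real_derivative (flat_exp (n + 2) t - real n * flat_exp (n + 1) t)) (at t)"
      using 2 by (simp add: flat_exp_def)
    then show ?thesis
      by (rule has_field_derivative_transform_within_open[where S="{..<0}"]) (use 2 in \<open>auto simp: flat_exp_def\<close>)
  next
    case 3
    \<comment> \<open>The difference quotient of \<open>flat_exp n\<close> at \<open>0\<close> is
      \<open>flat_exp (n + 1)\<close>, so differentiability there reduces to the limit already
      known.\<close>
    have "((\<lambda>h. (flat_exp n (0 + h) - flat_exp n 0) / h) \<longlongrightarrow> 0) (at 0)"
      by (rule Lim_transform_eventually[OF flat_exp_lim[of "n + 1"]])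
         (auto simp: eventually_at_filter flat_exp_def field_simps)
    then show ?thesis using 3 by (simp add: DERIV_def flat_exp_def)
  qed
qed

lemma Ck_on_flat_exp:
  assumes "\<And>k. Ck_on k S u"
  shows "Ck_on k S (\<lambda>x. flat_exp n (u x))"
proof (induction k arbitrary: n)
  case 0
  have "continuous_on UNIV (flat_exp n)"
    by (intro continuous_at_imp_continuous_on ballI DERIV_isCont[OF flat_exp_deriv])
  moreover have "continuous_on S u" using assms[of 0] by simp
  ultimately show ?case by (auto intro: continuous_on_compose2)
next
  case (Suc k)
  obtain u' where u': "\<forall>x\<in>S. (u has_derivative (\<lambda>h. u' x \<bullet> h)) (at x within S)"
    "\<forall>i. Ck_on k S (\<lambda>x. u' x $ i)" using assms[of "Suc k"] by auto
  let ?d = "\<lambda>x. (flat_exp (n + 2) (u x) + (- real n) * flat_exp (n + 1) (u x)) *\<^sub>R u' x"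
  have "((\<lambda>x. flat_exp n (u x)) has_derivative (\<lambda>h. ?d x \<bullet> h)) (at x within S)" if "x \<in> S" for x
    by (rule has_derivative_eq_rhs[OF has_derivative_compose[OF u'(1)[rule_format, OF that]
         flat_exp_deriv[of n "u x", unfolded has_field_derivative_def]]]) auto
  moreover have "Ck_on k S (\<lambda>x. ?d x $ i)" for i
    unfolding vector_scaleR_component real_scaleR_def
    by (intro Ck_on_mult Ck_on_add Ck_on_const Suc u'(2)[rule_format])
  ultimately show ?case by (simp, intro exI[of _ ?d]) auto
qed

text \<open>Squaring the distance leaves a polynomial inside \<open>flat_exp\<close>, so that the
  centre of the ball causes no loss of smoothness.\<close>

definition bump :: "real^3 \<Rightarrow> real \<Rightarrow> real^3 \<Rightarrow> real" where
  "bump a r x = flat_exp 0 (r\<^sup>2 - (dist x a)\<^sup>2)"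

lemma bump_pos: "x \<in> ball a r \<Longrightarrow> bump a r x > 0"
  by (auto simp: bump_def flat_exp_def dist_commute intro!: power_strict_mono)

lemma bump_zero: "r > 0 \<Longrightarrow> x \<notin> ball a r \<Longrightarrow> bump a r x = 0"
  by (auto simp: bump_def flat_exp_def dist_commute not_less intro!: power_mono)

lemma Ck_on_bump: "Ck_on k S (bump a r)"
proof -
  have "Ck_on k S (\<lambda>x. r\<^sup>2 + (-1) * (\<Sum>i\<in>UNIV. (x $ i + (- a $ i)) * (x $ i + (- a $ i))))" for k
    by (intro Ck_on_add Ck_on_mult Ck_on_const Ck_on_sum Ck_on_component)
  then have "Ck_on k S (\<lambda>x. r\<^sup>2 - (dist x a)\<^sup>2)" for k
    by (rule Ck_on_cong)
      (simp add: dist_norm power2_norm_eq_inner inner_vec_def)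
  then show ?thesis unfolding bump_def by (rule Ck_on_flat_exp)
qed

section \<open>Charts and transition maps\<close>

lemma orientation_factor_mult:
  "orientation_factor \<tau> (A ** B) = orientation_factor \<tau> A * orientation_factor \<tau> B"
  by (cases \<tau>) (simp_all add: orientation_factor_def det_mul sgn_mult)

lemma orientation_factor_square:
  "det A \<noteq> 0 \<Longrightarrow> orientation_factor \<tau> A * orientation_factor \<tau> A = 1"
  by (cases \<tau>) (simp_all add: orientation_factor_def sgn_mult[symmetric])

text \<open>The segment from the identity to \<open>A\<close> consists of positive definite
  matrices, none of them singular, so the determinant keeps the sign it has at the identity.\<close>

lemma positive_definite_det_pos:
  fixes A :: "real^'n^'n"
  assumes "\<And>u. u \<noteq> 0 \<Longrightarrow> u \<bullet> (A *v u) > 0"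
  shows "det A > 0"
proof (rule ccontr)
  define C where "C = (\<lambda>t::real. (1 - t) *\<^sub>R mat 1 + t *\<^sub>R A)"
  assume "\<not> det A > 0"
  moreover have "continuous_on {0..1} (\<lambda>t. det (C t))"
    unfolding det_def C_def by (auto intro!: continuous_intros)
  \<comment> \<open>\<open>det (C 0) = 1\<close> and \<open>det (C 1) = det A\<close>, so a
    determinant of \<open>A\<close> that is not positive forces a zero on the segment.\<close>
  ultimately obtain t where t: "0 \<le> t" "t \<le> 1" "det (C t) = 0"
    using IVT2'[of "\<lambda>t. det (C t)" 1 0 0] by (auto simp: C_def)
  then obtain u where u: "u \<noteq> 0" "C t *v u = 0"
    by (metis invertible_det_nz invertible_left_inverse matrix_left_invertible_ker)
  have "0 = u \<bullet> (C t *v u)" using u by simp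
  also have "\<dots> = (1 - t) * (u \<bullet> u) + t * (u \<bullet> (A *v u))"
    by (simp add: C_def matrix_vector_mult_add_rdistrib scaleR_matrix_vector_assoc[symmetric] inner_add_right)
  also have "\<dots> > 0"
    using t(1,2) assms[OF u(1)] u(1)
    by (cases "t = 0") (auto intro!: add_nonneg_pos)
  finally show False by simp
qed

locale riemannian_manifold3 =
  fixes M :: "'a::{t2_space, second_countable_topology} riemann3"
  assumes manifold: "riemannian_3_manifold M"
begin

definition overlap :: "'a chart \<Rightarrow> 'a chart \<Rightarrow> (real^3) set" where
  "overlap \<kappa> \<kappa>' = cmap \<kappa> ` (cdom \<kappa> \<inter> cdom \<kappa>')"

lemma
  assumes "\<kappa> \<in> atlas M"
  shows chart_homeomorphism: "homeomorphism (cdom \<kappa>) (cimg \<kappa>) (cmap \<kappa>) (cinv \<kappa>)"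
    and cdom_openin: "openin (top_of_set (points M)) (cdom \<kappa>)"
    and cimg_half_space_open: "half_space_open (cimg \<kappa>)"
    and chart_inj: "inj_on (cmap \<kappa>) (cdom \<kappa>)"
  using assms manifold
  unfolding riemannian_3_manifold_def is_chart_def half_space_open_def by blast+

lemma
  assumes "\<kappa> \<in> atlas M"
  shows cinv_cmap: "p \<in> cdom \<kappa> \<Longrightarrow> cinv \<kappa> (cmap \<kappa> p) = p"
    and cinv_in_cdom: "x \<in> cimg \<kappa> \<Longrightarrow> cinv \<kappa> x \<in> cdom \<kappa>"
    and cmap_cinv: "x \<in> cimg \<kappa> \<Longrightarrow> cmap \<kappa> (cinv \<kappa> x) = x"
  using chart_homeomorphism[OF assms] by (auto simp: homeomorphism_def)

lemma openin_cmap_image: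
  assumes "\<kappa> \<in> atlas M" "openin (top_of_set (points M)) U" "U \<subseteq> cdom \<kappa>"
  shows "openin (top_of_set (cimg \<kappa>)) (cmap \<kappa> ` U)"
proof -
  have "openin (top_of_set (cdom \<kappa>)) U"
    using assms cdom_openin[OF assms(1)] by (meson openin_subset_trans openin_imp_subset)
  then show ?thesis
    using homeomorphism_imp_open_map[OF chart_homeomorphism[OF assms(1)]] by simp
qed

lemma overlap_openin:
  assumes "\<kappa> \<in> atlas M" "\<kappa>' \<in> atlas M"
  shows "openin (top_of_set (cimg \<kappa>)) (overlap \<kappa> \<kappa>')"
  unfolding overlap_def
  using assms by (intro openin_cmap_image openin_Int cdom_openin) auto

lemma overlap_half_space_open:
  "\<kappa> \<in> atlas M \<Longrightarrow> \<kappa>' \<in> atlas M \<Longrightarrow> half_space_open (overlap \<kappa> \<kappa>')"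
  using half_space_open_openin cimg_half_space_open overlap_openin by blast

lemma transition_smooth:
  assumes "\<kappa> \<in> atlas M" "\<kappa>' \<in> atlas M"
  shows "Ck_on k (overlap \<kappa> \<kappa>') (\<lambda>x. cmap \<kappa>' (cinv \<kappa> x) $ i)"
  using assms manifold unfolding riemannian_3_manifold_def smooth_on_def overlap_def by blast

text \<open>\<open>jacobian\<close> is the matrix of a chosen Frechet derivative and says nothing
  until differentiability is known; class 1 of the transition components supplies it.\<close>

lemma transition_has_derivative:
  assumes "\<kappa> \<in> atlas M" "\<kappa>' \<in> atlas M" "p \<in> cdom \<kappa>" "p \<in> cdom \<kappa>'"
  shows "((\<lambda>x. cmap \<kappa>' (cinv \<kappa> x)) has_derivative (\<lambda>h. jacobian \<kappa> \<kappa>' p *v h))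
    (at (cmap \<kappa> p) within overlap \<kappa> \<kappa>')"
proof -
  have x: "cmap \<kappa> p \<in> overlap \<kappa> \<kappa>'" using assms by (auto simp: overlap_def)
  have "\<exists>g. ((\<lambda>x. cmap \<kappa>' (cinv \<kappa> x) $ i) has_derivative (\<lambda>h. g \<bullet> h))
      (at (cmap \<kappa> p) within overlap \<kappa> \<kappa>')" for i
    using transition_smooth[OF assms(1,2), of "Suc 0" i] x by auto
  then obtain g where g: "\<And>i. ((\<lambda>x. cmap \<kappa>' (cinv \<kappa> x) $ i) has_derivative (\<lambda>h. g i \<bullet> h))
      (at (cmap \<kappa> p) within overlap \<kappa> \<kappa>')" by metis
  have "(\<lambda>x. cmap \<kappa>' (cinv \<kappa> x)) differentiable (at (cmap \<kappa> p) within overlap \<kappa> \<kappa>')"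
    by (rule differentiableI, rule has_derivative_vec_componentwise, rule g)
  then have d: "((\<lambda>x. cmap \<kappa>' (cinv \<kappa> x)) has_derivative
      frechet_derivative (\<lambda>x. cmap \<kappa>' (cinv \<kappa> x)) (at (cmap \<kappa> p) within overlap \<kappa> \<kappa>'))
      (at (cmap \<kappa> p) within overlap \<kappa> \<kappa>')"
    by (simp add: frechet_derivative_works)
  then show ?thesis
    unfolding jacobian_def overlap_def
    using matrix_vector_mul(2)[OF has_derivative_linear[OF d[unfolded overlap_def]]] by simp
qed

text \<open>Smoothness of the transition map yields smooth gradients, but not that they are the rows
  of \<open>jacobian\<close>; uniqueness of derivatives on the overlap identifies the two.\<close>

lemma jacobian_smooth:
  assumes "\<kappa> \<in> atlas M" "\<kappa>' \<in> atlas M"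
  shows "Ck_on k (overlap \<kappa> \<kappa>') (\<lambda>x. jacobian \<kappa> \<kappa>' (cinv \<kappa> x) $ i $ j)"
proof -
  obtain g where g: "\<And>x. x \<in> overlap \<kappa> \<kappa>' \<Longrightarrow>
      ((\<lambda>x. cmap \<kappa>' (cinv \<kappa> x) $ i) has_derivative (\<lambda>h. g x \<bullet> h)) (at x within overlap \<kappa> \<kappa>')"
    "\<And>j. Ck_on k (overlap \<kappa> \<kappa>') (\<lambda>x. g x $ j)"
    using transition_smooth[OF assms, of "Suc k" i] by auto
  show ?thesis
  proof (rule Ck_on_cong[OF g(2)])
    fix x assume x: "x \<in> overlap \<kappa> \<kappa>'"
    then obtain p where p: "x = cmap \<kappa> p" "p \<in> cdom \<kappa>" "p \<in> cdom \<kappa>'" by (auto simp: overlap_def)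
    from bounded_linear.has_derivative[OF bounded_linear_vec_nth transition_has_derivative[OF assms p(2,3)]]
    have "((\<lambda>x. cmap \<kappa>' (cinv \<kappa> x) $ i) has_derivative (\<lambda>h. (jacobian \<kappa> \<kappa>' p *v h) $ i))
      (at x within overlap \<kappa> \<kappa>')" by (simp add: p(1))
    from fun_cong[OF half_space_open_derivative_unique[OF overlap_half_space_open[OF assms] x g(1)[OF x] this]]
    have "g x \<bullet> axis j 1 = (jacobian \<kappa> \<kappa>' p *v axis j 1) $ i" .
    then show "g x $ j = jacobian \<kappa> \<kappa>' (cinv \<kappa> x) $ i $ j"
      using p assms by (simp add: inner_axis cinv_cmap matrix_vector_mult_basis column_def)
  qed
qed

text \<open>The chain rule. It makes sense only where all three charts are defined, so every
  derivative is restricted to the triple overlap, which is still open enough for uniqueness.\<close>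

lemma jacobian_cocycle:
  assumes "\<kappa> \<in> atlas M" "\<kappa>' \<in> atlas M" "\<kappa>'' \<in> atlas M"
    and p: "p \<in> cdom \<kappa>" "p \<in> cdom \<kappa>'" "p \<in> cdom \<kappa>''"
  shows "jacobian \<kappa> \<kappa>'' p = jacobian \<kappa>' \<kappa>'' p ** jacobian \<kappa> \<kappa>' p"
proof -
  define T where "T = cmap \<kappa> ` (cdom \<kappa> \<inter> cdom \<kappa>' \<inter> cdom \<kappa>'')"
  have T: "half_space_open T" "cmap \<kappa> p \<in> T" "T \<subseteq> overlap \<kappa> \<kappa>'" "T \<subseteq> overlap \<kappa> \<kappa>''"
    "(\<lambda>x. cmap \<kappa>' (cinv \<kappa> x)) ` T \<subseteq> overlap \<kappa>' \<kappa>''"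
    using assms
    by (auto simp: T_def overlap_def cinv_cmap intro!: half_space_open_openin[OF cimg_half_space_open] openin_cmap_image
        openin_Int cdom_openin)
  have 1: "((\<lambda>x. cmap \<kappa>'' (cinv \<kappa> x)) has_derivative (\<lambda>h. jacobian \<kappa> \<kappa>'' p *v h)) (at (cmap \<kappa> p) within T)"
    using transition_has_derivative[OF assms(1,3) p(1,3)] T(4) by (rule has_derivative_subset)
  have "((\<lambda>x. cmap \<kappa>' (cinv \<kappa> x)) has_derivative (\<lambda>h. jacobian \<kappa> \<kappa>' p *v h)) (at (cmap \<kappa> p) within T)"
    using transition_has_derivative[OF assms(1,2) p(1,2)] T(3) by (rule has_derivative_subset)
  moreover have "((\<lambda>x. cmap \<kappa>'' (cinv \<kappa>' x)) has_derivative (\<lambda>h. jacobian \<kappa>' \<kappa>'' p *v h))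
      (at (cmap \<kappa>' (cinv \<kappa> (cmap \<kappa> p))) within (\<lambda>x. cmap \<kappa>' (cinv \<kappa> x)) ` T)"
    using transition_has_derivative[OF assms(2,3) p(2,3)] T(5) assms
    by (auto simp: cinv_cmap intro: has_derivative_subset)
  ultimately have "((\<lambda>x. cmap \<kappa>'' (cinv \<kappa>' (cmap \<kappa>' (cinv \<kappa> x)))) has_derivative
      (\<lambda>h. jacobian \<kappa>' \<kappa>'' p *v (jacobian \<kappa> \<kappa>' p *v h))) (at (cmap \<kappa> p) within T)"
    by (rule has_derivative_in_compose)
  then have 2: "((\<lambda>x. cmap \<kappa>'' (cinv \<kappa> x)) has_derivative
      (\<lambda>h. jacobian \<kappa>' \<kappa>'' p *v (jacobian \<kappa> \<kappa>' p *v h))) (at (cmap \<kappa> p) within T)"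
    by (rule has_derivative_transform[OF T(2), rotated])
       (use assms in \<open>auto simp: T_def cinv_cmap\<close>)
  from half_space_open_derivative_unique[OF T(1,2) 1 2] show ?thesis
    by (auto simp: matrix_eq matrix_vector_mul_assoc dest: fun_cong)
qed

lemma metric_transform:
  "\<kappa> \<in> atlas M \<Longrightarrow> \<kappa>' \<in> atlas M \<Longrightarrow> p \<in> cdom \<kappa> \<Longrightarrow> p \<in> cdom \<kappa>' \<Longrightarrow>
   metric M \<kappa> p = transpose (jacobian \<kappa> \<kappa>' p) ** metric M \<kappa>' p ** jacobian \<kappa> \<kappa>' p"
  using manifold unfolding riemannian_3_manifold_def by blast

lemma det_metric_pos: "\<kappa> \<in> atlas M \<Longrightarrow> p \<in> cdom \<kappa> \<Longrightarrow> det (metric M \<kappa> p) > 0"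
  using manifold unfolding riemannian_3_manifold_def
  by (intro positive_definite_det_pos) blast

text \<open>Determinants in the metric law give \<open>det g = (det J)^2 det g'\<close>, and the
  left side is positive.\<close>

lemma det_jacobian_nonzero:
  assumes "\<kappa> \<in> atlas M" "\<kappa>' \<in> atlas M" "p \<in> cdom \<kappa>" "p \<in> cdom \<kappa>'"
  shows "det (jacobian \<kappa> \<kappa>' p) \<noteq> 0"
  using det_metric_pos[OF assms(1,3)] metric_transform[OF assms] by (auto simp: det_mul)

lemma orientation_factor_smooth:
  assumes "\<kappa> \<in> atlas M" "\<kappa>' \<in> atlas M"
  shows "Ck_on k (overlap \<kappa> \<kappa>') (\<lambda>x. orientation_factor \<tau> (jacobian \<kappa> \<kappa>' (cinv \<kappa> x)))"
proof (cases \<tau>)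
  case Straight
  then show ?thesis by (simp add: orientation_factor_def Ck_on_const)
next
  case Twisted
  have "continuous_on (overlap \<kappa> \<kappa>') (\<lambda>x. jacobian \<kappa> \<kappa>' (cinv \<kappa> x) $ i $ j)" for i j
    using jacobian_smooth[OF assms] Ck_on_continuous by blast
  then have "continuous_on (overlap \<kappa> \<kappa>') (\<lambda>x. det (jacobian \<kappa> \<kappa>' (cinv \<kappa> x)))"
    unfolding det_def by (intro continuous_on_sum continuous_on_mult continuous_on_const continuous_on_prod)
  then show ?thesis
    using Twisted assms det_jacobian_nonzero[OF assms]
    by (auto simp: orientation_factor_def overlap_def cinv_cmap intro!: Ck_on_sgn)
qed

section \<open>Countable Borel partitions into charts and the integral of forms\<close>

lemma cdom_subset: "\<kappa> \<in> atlas M \<Longrightarrow> cdom \<kappa> \<subseteq> points M"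
  using cdom_openin openin_imp_subset by blast

lemma borel_cmap_image:
  assumes "\<kappa> \<in> atlas M" "openin (top_of_set (points M)) U" "U \<subseteq> cdom \<kappa>"
  shows "cmap \<kappa> ` U \<in> sets borel"
proof -
  have "half_space_open (cmap \<kappa> ` U)"
    using half_space_open_openin[OF cimg_half_space_open openin_cmap_image] assms by blast
  moreover have "closed half_space"
    unfolding half_space_def by (intro closed_Collect_le continuous_intros)
  ultimately show ?thesis
    by (auto simp: half_space_open_def openin_open)
qed

text \<open>\<open>some_partition\<close> is a choice and carries information only if a partition
  exists. Second countability reduces the cover by chart domains to a countable one, which is then
  made disjoint; the pieces have Borel images since overlaps have relatively open images.\<close>

lemma chart_partition_exists: "\<exists>K A. chart_partition M K A"
proof -
  obtain \<F> where \<F>: "\<F> \<subseteq> cdom ` atlas M" "countable \<F>" "\<Union>\<F> = points M"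
  proof (rule Lindelof_openin[of "cdom ` atlas M" "points M"])
    have "\<Union> (cdom ` atlas M) = points M" using manifold unfolding riemannian_3_manifold_def by blast
    then show "\<And>\<F>'. \<F>' \<subseteq> cdom ` atlas M \<Longrightarrow> countable \<F>' \<Longrightarrow> \<Union>\<F>' = \<Union> (cdom ` atlas M) \<Longrightarrow> thesis"
      using that by simp
  qed (use cdom_openin in auto)
  show ?thesis
  proof (cases "\<F> = {}")
    case True
    \<comment> \<open>An empty subcover means an empty manifold: all pieces are empty, and any chart
      may be attached to them.\<close>
    then have "chart_partition M (\<lambda>n. undefined) (\<lambda>n. {})"
      using \<F> by (auto simp: chart_partition_def disjoint_family_on_def)
    then show ?thesis by blast
  next
    case False
    have "\<exists>\<kappa>\<in>atlas M. from_nat_into \<F> n = cdom \<kappa>" for n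
      using from_nat_into[OF False, of n] \<F>(1) by auto
    then obtain K where K: "\<And>n. K n \<in> atlas M" "\<And>n. from_nat_into \<F> n = cdom (K n)" by metis
    define A where "A n = cdom (K n) - (\<Union>m<n. cdom (K m))" for n
    have A: "A = disjointed (\<lambda>n. cdom (K n))"
      by (auto simp: fun_eq_iff A_def disjointed_def atLeast0LessThan)
    have "(\<Union>n. A n) = points M"
      unfolding A UN_disjointed_eq K(2)[symmetric] range_from_nat_into[OF False \<F>(2)] by (rule \<F>(3))
    moreover have "disjoint_family A" unfolding A by (rule disjoint_family_disjointed)
    moreover have "cmap (K n) ` A n \<in> sets borel" for n
    proof -
      have "cmap (K n) ` A n = cimg (K n) - (\<Union>m<n. cmap (K n) ` (cdom (K n) \<inter> cdom (K m)))"
      proof -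
        have "A n = cdom (K n) - (\<Union>m<n. cdom (K n) \<inter> cdom (K m))" by (auto simp: A_def)
        then show ?thesis
          using inj_on_image_set_diff[OF chart_inj[OF K(1)[of n]], of "cdom (K n)" "\<Union>m<n. cdom (K n) \<inter> cdom (K m)"]
          by (auto simp: image_UN)
      qed
      moreover have "cimg (K n) \<in> sets borel" "\<And>m. cmap (K n) ` (cdom (K n) \<inter> cdom (K m)) \<in> sets borel"
        using K(1) by (auto intro!: borel_cmap_image cdom_openin openin_Int)
      ultimately show ?thesis by auto
    qed
    ultimately have "chart_partition M K A"
      using K by (auto simp: chart_partition_def A_def)
    then show ?thesis by blast
  qed
qed

lemma some_partition_chart_partition:
  obtains K A where "some_partition M = (K, A)" "chart_partition M K A"
proof -
  have "case some_partition M of (K, A) \<Rightarrow> chart_partition M K A"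
    unfolding some_partition_def by (rule someI_ex) (use chart_partition_exists in auto)
  then show ?thesis using that by (cases "some_partition M") auto
qed

text \<open>Hides the chosen partition. An empty piece may carry a chart outside the atlas, hence
  the separate case.\<close>

lemma piece_cases:
  obtains "piece M n = {}"
  | \<kappa> A where "\<kappa> \<in> atlas M" "A \<subseteq> cdom \<kappa>" "piece M n = cmap \<kappa> ` A"
    "\<And>\<omega> x. local_density M \<omega> n x = \<omega> \<kappa> (cinv \<kappa> x) coordinate_frame"
proof -
  obtain K A where "some_partition M = (K, A)" "chart_partition M K A"
    by (rule some_partition_chart_partition)
  then show ?thesis
    using that(1) that(2)[of "K n" "A n"]
    by (cases "A n = {}") (auto simp: chart_partition_def piece_def local_density_def)
qed

lemma local_density_cong:
  assumes "\<And>\<kappa> p. \<kappa> \<in> atlas M \<Longrightarrow> p \<in> cdom \<kappa> \<Longrightarrow> \<omega> \<kappa> p coordinate_frame = \<eta> \<kappa> p coordinate_frame"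
    and "x \<in> piece M n"
  shows "local_density M \<omega> n x = local_density M \<eta> n x"
proof (rule piece_cases[of n])
  fix \<kappa> A assume *: "\<kappa> \<in> atlas M" "A \<subseteq> cdom \<kappa>" "piece M n = cmap \<kappa> ` A"
    "\<And>\<omega> x. local_density M \<omega> n x = \<omega> \<kappa> (cinv \<kappa> x) coordinate_frame"
  then have "cinv \<kappa> x \<in> cdom \<kappa>" using assms(2) cinv_in_cdom by blast
  with * assms(1) show ?thesis by simp
qed (use assms(2) in simp)

text \<open>The integral reads a form only through its value on the coordinate frame in charts of
  the atlas. Identities of 3-forms are therefore proved for that frame alone in what
  follows.\<close>

lemma
  assumes "\<And>\<kappa> p. \<kappa> \<in> atlas M \<Longrightarrow> p \<in> cdom \<kappa> \<Longrightarrow> \<omega> \<kappa> p coordinate_frame = \<eta> \<kappa> p coordinate_frame"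
  shows form_integral_cong: "form_integral M \<omega> = form_integral M \<eta>"
    and form_integrable_cong: "form_integrable M \<omega> \<longleftrightarrow> form_integrable M \<eta>"
proof -
  have 1: "indicator (piece M n) x *\<^sub>R local_density M \<omega> n x = indicator (piece M n) x *\<^sub>R local_density M \<eta> n x"
    "indicator (piece M n) x *\<^sub>R \<bar>local_density M \<omega> n x\<bar> = indicator (piece M n) x *\<^sub>R \<bar>local_density M \<eta> n x\<bar>" for x n
    using local_density_cong[of \<omega> \<eta> x n] assms by (auto simp: indicator_def)
  show "form_integral M \<omega> = form_integral M \<eta>" "form_integrable M \<omega> \<longleftrightarrow> form_integrable M \<eta>"
    unfolding form_integral_def form_integrable_def set_lebesgue_integral_def set_integrable_def 1 by simp_all
qed

end

section \<open>Integrals of differences of forms\<close>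

lemma local_density_diff:
  "local_density M (\<lambda>\<kappa> p v. \<omega> \<kappa> p v - \<eta> \<kappa> p v) n x = local_density M \<omega> n x - local_density M \<eta> n x"
  by (simp add: local_density_def split: prod.split)

lemma form_integral_summable:
  assumes "form_integrable M \<omega>"
  shows "summable (\<lambda>n. LINT x:piece M n|lborel. local_density M \<omega> n x)"
proof (rule summable_comparison_test')
  show "summable (\<lambda>n. LINT x:piece M n|lborel. \<bar>local_density M \<omega> n x\<bar>)"
    using assms by (simp add: form_integrable_def)
  fix n
  show "norm (LINT x:piece M n|lborel. local_density M \<omega> n x)
    \<le> (LINT x:piece M n|lborel. \<bar>local_density M \<omega> n x\<bar>)"
    using assms set_integral_norm_bound[of lborel "piece M n" "local_density M \<omega> n"]
    by (simp add: form_integrable_def)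
qed

lemma
  assumes "form_integrable M \<omega>" "form_integrable M \<eta>"
  shows form_integral_diff:
      "form_integral M (\<lambda>\<kappa> p v. \<omega> \<kappa> p v - \<eta> \<kappa> p v) = form_integral M \<omega> - form_integral M \<eta>"
    and form_integrable_diff: "form_integrable M (\<lambda>\<kappa> p v. \<omega> \<kappa> p v - \<eta> \<kappa> p v)"
proof -
  have i: "set_integrable lborel (piece M n) (local_density M \<omega> n)"
    "set_integrable lborel (piece M n) (local_density M \<eta> n)" for n
    using assms by (simp_all add: form_integrable_def)
  show "form_integral M (\<lambda>\<kappa> p v. \<omega> \<kappa> p v - \<eta> \<kappa> p v) = form_integral M \<omega> - form_integral M \<eta>"
    unfolding form_integral_def local_density_diff
    by (simp add: set_integral_diff(2)[OF i] suminf_diff[OF form_integral_summable form_integral_summable] assms)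
  have d: "set_integrable lborel (piece M n) (\<lambda>x. local_density M \<omega> n x - local_density M \<eta> n x)" for n
    by (intro set_integral_diff i)
  moreover have "summable (\<lambda>n. LINT x:piece M n|lborel. \<bar>local_density M \<omega> n x - local_density M \<eta> n x\<bar>)"
  proof (rule summable_comparison_test')
    show "summable (\<lambda>n. (LINT x:piece M n|lborel. \<bar>local_density M \<omega> n x\<bar>)
      + (LINT x:piece M n|lborel. \<bar>local_density M \<eta> n x\<bar>))"
      using assms by (intro summable_add) (simp_all add: form_integrable_def)
    fix n
    have "(LINT x:piece M n|lborel. \<bar>local_density M \<omega> n x - local_density M \<eta> n x\<bar>)
      \<le> (LINT x:piece M n|lborel. \<bar>local_density M \<omega> n x\<bar> + \<bar>local_density M \<eta> n x\<bar>)"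
      by (intro set_integral_mono set_integral_add set_integrable_abs i d) auto
    also have "\<dots> = (LINT x:piece M n|lborel. \<bar>local_density M \<omega> n x\<bar>)
      + (LINT x:piece M n|lborel. \<bar>local_density M \<eta> n x\<bar>)"
      by (intro set_integral_add set_integrable_abs i)
    finally show "norm (LINT x:piece M n|lborel. \<bar>local_density M \<omega> n x - local_density M \<eta> n x\<bar>)
      \<le> (LINT x:piece M n|lborel. \<bar>local_density M \<omega> n x\<bar>)
        + (LINT x:piece M n|lborel. \<bar>local_density M \<eta> n x\<bar>)"
      by (simp add: set_lebesgue_integral_def integral_nonneg_AE)
  qed
  moreover have "local_density M (\<lambda>\<kappa> p v. \<omega> \<kappa> p v - \<eta> \<kappa> p v)
      = (\<lambda>n x. local_density M \<omega> n x - local_density M \<eta> n x)"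
    by (simp add: fun_eq_iff local_density_diff)
  ultimately show "form_integrable M (\<lambda>\<kappa> p v. \<omega> \<kappa> p v - \<eta> \<kappa> p v)"
    by (simp add: form_integrable_def)
qed

section \<open>The fundamental lemma of the calculus of variations\<close>

lemma vol_coordinate_frame: "vol M \<kappa> p coordinate_frame = sqrt (det (metric M \<kappa> p))"
  by (simp add: vol_def coordinate_frame_def det_3 axis_def vector_def)

context riemannian_manifold3
begin

text \<open>A vector \<open>u\<close>, constant in the coordinates of \<open>\<kappa>\<close>, cut
  off by a bump and written in every chart by the transformation law of parity
  \<open>\<tau>\<close>. Referring all charts to the one chart \<open>\<kappa>\<close> turns the law
  between two further charts into the cocycle identity.\<close>

definition bump_field :: "parity \<Rightarrow> 'a chart \<Rightarrow> real^3 \<Rightarrow> real \<Rightarrow> real^3 \<Rightarrow> 'a vfield" where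
  "bump_field \<tau> \<kappa> a r u = (\<lambda>\<kappa>' p.
     if \<kappa>' \<in> atlas M \<and> p \<in> cdom \<kappa>' \<and> p \<in> cdom \<kappa>
     then (orientation_factor \<tau> (jacobian \<kappa> \<kappa>' p) * bump a r (cmap \<kappa> p)) *\<^sub>R (jacobian \<kappa> \<kappa>' p *v u)
     else 0)"

lemma compact_cinv_cball:
  assumes "\<kappa> \<in> atlas M" "cball a r \<subseteq> cimg \<kappa>"
  shows "compact (cinv \<kappa> ` cball a r)"
proof (rule compact_continuous_image)
  show "continuous_on (cball a r) (cinv \<kappa>)"
    using chart_homeomorphism[OF assms(1)] assms(2)
    by (auto simp: homeomorphism_def intro: continuous_on_subset)
qed simp

lemma bump_field_zero:
  assumes "\<kappa> \<in> atlas M" "r > 0" "p \<notin> cinv \<kappa> ` cball a r"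
  shows "bump_field \<tau> \<kappa> a r u \<kappa>' p = 0"
proof (cases "p \<in> cdom \<kappa>")
  case True
  then have "cmap \<kappa> p \<notin> cball a r" using assms(1,3) cinv_cmap by (metis imageI)
  then have "bump a r (cmap \<kappa> p) = 0" using assms(2) by (intro bump_zero) auto
  then show ?thesis by (simp add: bump_field_def)
qed (simp add: bump_field_def)

text \<open>The danger is a point of \<open>\<kappa>'\<close> at the edge of the overlap with
  \<open>\<kappa>\<close>. The support lies in a compact set, which is closed in a Hausdorff space
  and so stays away from such points; this is what lets \<open>Ck_on_extend_zero\<close>
  apply.\<close>

lemma bump_field_smooth:
  assumes \<kappa>: "\<kappa> \<in> atlas M" "\<kappa>' \<in> atlas M" and r: "r > 0" "cball a r \<subseteq> cimg \<kappa>"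
  shows "Ck_on k (cimg \<kappa>') (\<lambda>x. bump_field \<tau> \<kappa> a r u \<kappa>' (cinv \<kappa>' x) $ i)"
proof (rule Ck_on_extend_zero)
  define K where "K = cinv \<kappa> ` cball a r"
  have K: "K \<subseteq> cdom \<kappa>" using r(2) cinv_in_cdom[OF \<kappa>(1)] by (auto simp: K_def)
  have "closed K" using compact_cinv_cball[OF \<kappa>(1) r(2)] by (simp add: K_def compact_imp_closed)
  then have "openin (top_of_set (points M)) (cdom \<kappa>' - K)"
    using cdom_openin[OF \<kappa>(2)] unfolding Diff_eq by (intro openin_Int_open) auto
  then have "openin (top_of_set (cimg \<kappa>')) (cmap \<kappa>' ` (cdom \<kappa>' - K))"
    by (intro openin_cmap_image \<kappa>) auto
  moreover have "cmap \<kappa>' ` (cdom \<kappa>' - K) = cimg \<kappa>' - cmap \<kappa>' ` (cdom \<kappa>' \<inter> K)"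
    using inj_on_image_set_diff[OF chart_inj[OF \<kappa>(2)], of "cdom \<kappa>'" "cdom \<kappa>' \<inter> K"]
    by (auto simp: Diff_Int_distrib)
  ultimately show "closedin (top_of_set (cimg \<kappa>')) (cmap \<kappa>' ` (cdom \<kappa>' \<inter> K))"
    by (auto simp: closedin_def)
  show "cmap \<kappa>' ` (cdom \<kappa>' \<inter> K) \<subseteq> overlap \<kappa>' \<kappa>" using K by (auto simp: overlap_def)
  show "bump_field \<tau> \<kappa> a r u \<kappa>' (cinv \<kappa>' x) $ i = 0"
    if "x \<in> cimg \<kappa>' - cmap \<kappa>' ` (cdom \<kappa>' \<inter> K)" for x
  proof -
    have "cinv \<kappa>' x \<notin> K"
      using that cinv_in_cdom[OF \<kappa>(2), of x] cmap_cinv[OF \<kappa>(2), of x] by (metis DiffE IntI imageI)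
    then show ?thesis using bump_field_zero[OF \<kappa>(1) r(1)] by (simp add: K_def)
  qed
  \<comment> \<open>Smoothness is wanted in the coordinates of \<open>\<kappa>'\<close>, while the
    coefficients are known to be smooth in those of \<open>\<kappa>\<close>; the transition map
    pulls them back.\<close>
  let ?\<tau> = "\<lambda>x. cmap \<kappa> (cinv \<kappa>' x)"
  have sub: "?\<tau> ` overlap \<kappa>' \<kappa> \<subseteq> overlap \<kappa> \<kappa>'"
    using \<kappa> by (auto simp: overlap_def cinv_cmap)
  note comp = Ck_on_compose[OF _ transition_smooth[OF \<kappa>(2,1)] sub]
  have "Ck_on k (overlap \<kappa>' \<kappa>) (\<lambda>x. orientation_factor \<tau> (jacobian \<kappa> \<kappa>' (cinv \<kappa> (?\<tau> x))) * bump a r (?\<tau> x)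
      * (\<Sum>j\<in>UNIV. jacobian \<kappa> \<kappa>' (cinv \<kappa> (?\<tau> x)) $ i $ j * u $ j))"
    by (intro Ck_on_mult Ck_on_sum Ck_on_const comp orientation_factor_smooth jacobian_smooth Ck_on_bump \<kappa>)
  then show "Ck_on k (overlap \<kappa>' \<kappa>) (\<lambda>x. bump_field \<tau> \<kappa> a r u \<kappa>' (cinv \<kappa>' x) $ i)"
    by (rule Ck_on_cong)
       (use \<kappa> in \<open>auto simp: overlap_def cinv_cmap bump_field_def matrix_vector_mult_def\<close>)
qed (use \<kappa> cimg_half_space_open overlap_openin in auto)

lemma bump_field_vector_field:
  assumes "\<kappa> \<in> atlas M" "r > 0" "cball a r \<subseteq> cimg \<kappa>"
  shows "bump_field \<tau> \<kappa> a r u \<in> vector_fields M \<tau>"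
  unfolding vector_fields_def smooth_on_def
proof (intro CollectI conjI allI ballI impI)
  show "bump_field \<tau> \<kappa> a r u \<kappa>' p = 0" if "\<not> (\<kappa>' \<in> atlas M \<and> p \<in> cdom \<kappa>')" for \<kappa>' p
    using that by (auto simp: bump_field_def)
  show "Ck_on k (cimg \<kappa>') (\<lambda>x. bump_field \<tau> \<kappa> a r u \<kappa>' (cinv \<kappa>' x) $ i)" if "\<kappa>' \<in> atlas M" for \<kappa>' i k
    using bump_field_smooth that assms by blast
  show "bump_field \<tau> \<kappa> a r u \<kappa>'' p = orientation_factor \<tau> (jacobian \<kappa>' \<kappa>'' p) *\<^sub>R
      (jacobian \<kappa>' \<kappa>'' p *v bump_field \<tau> \<kappa> a r u \<kappa>' p)"
    if "\<kappa>' \<in> atlas M" "\<kappa>'' \<in> atlas M" "p \<in> cdom \<kappa>' \<inter> cdom \<kappa>''" for \<kappa>' \<kappa>'' p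
    using that assms(1) jacobian_cocycle[of \<kappa> \<kappa>' \<kappa>'' p]
    by (auto simp: bump_field_def orientation_factor_mult matrix_vector_mul_assoc
        matrix_vector_mult_scaleR mult_ac)
qed

lemma cinv_interior_points:
  "\<kappa> \<in> atlas M \<Longrightarrow> x \<in> interior (cimg \<kappa>) \<Longrightarrow> cinv \<kappa> x \<in> interior_points M"
  using interior_subset[of "cimg \<kappa>"] cinv_in_cdom[of \<kappa> x] cmap_cinv[of \<kappa> x] cdom_subset[of \<kappa>]
  by (force simp: interior_points_def)

text \<open>A nonnegative density with vanishing integral is zero almost everywhere in each piece, and
  transition maps preserve null sets, so it is zero almost everywhere in every chart.\<close>

lemma nonneg_form_integral_zero_negligible:
  assumes \<kappa>: "\<kappa> \<in> atlas M"
    and nonneg: "\<And>\<kappa> p. \<kappa> \<in> atlas M \<Longrightarrow> p \<in> cdom \<kappa> \<Longrightarrow> \<omega> \<kappa> p coordinate_frame \<ge> 0"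
    and int: "form_integrable M \<omega>" "form_integral M \<omega> = 0"
    and U: "U \<subseteq> cdom \<kappa>"
    and pos: "\<And>\<kappa> p. \<kappa> \<in> atlas M \<Longrightarrow> p \<in> cdom \<kappa> \<Longrightarrow> p \<in> U \<Longrightarrow> \<omega> \<kappa> p coordinate_frame > 0"
  shows "negligible (cmap \<kappa> ` U)"
proof -
  obtain K A where KA: "some_partition M = (K, A)" "chart_partition M K A"
    by (rule some_partition_chart_partition)
  have ld: "local_density M \<omega> n x = \<omega> (K n) (cinv (K n) x) coordinate_frame" for n x
    by (simp add: local_density_def KA)
  have pc: "piece M n = cmap (K n) ` A n" for n by (simp add: piece_def KA)
  have An: "K n \<in> atlas M" "A n \<subseteq> cdom (K n)" if "A n \<noteq> {}" for n
    using KA(2) that by (auto simp: chart_partition_def)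
  have nn: "local_density M \<omega> n x \<ge> 0" if "x \<in> piece M n" for n x
  proof -
    obtain p where p: "p \<in> A n" "x = cmap (K n) p" using \<open>x \<in> piece M n\<close> by (auto simp: pc)
    then have k: "K n \<in> atlas M" "p \<in> cdom (K n)" using An[of n] by blast+
    have "cinv (K n) x = p" unfolding p(2) by (rule cinv_cmap[OF k])
    then show ?thesis unfolding ld using nonneg[OF k] by simp
  qed
  have int0: "(LINT x:piece M n|lborel. local_density M \<omega> n x) \<ge> 0" for n
    unfolding set_lebesgue_integral_def using nn
    by (intro integral_nonneg_AE AE_I2) (auto simp: indicator_def)
  \<comment> \<open>The pieces contribute nonnegative terms to a sum that is zero.\<close>
  have zero: "(LINT x:piece M n|lborel. local_density M \<omega> n x) = 0" for n
    using int(2) suminf_eq_zero_iff[OF form_integral_summable[OF int(1)] int0]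
    by (simp add: form_integral_def)
  have neg: "negligible {x \<in> piece M n. local_density M \<omega> n x \<noteq> 0}" for n
  proof -
    have "AE x in lborel. indicator (piece M n) x *\<^sub>R local_density M \<omega> n x = 0"
      using zero[of n] int(1) nn
      by (subst integral_nonneg_eq_0_iff_AE[symmetric])
         (auto simp: set_lebesgue_integral_def form_integrable_def set_integrable_def indicator_def)
    then obtain N where N: "N \<in> null_sets lborel"
      "{x. indicator (piece M n) x *\<^sub>R local_density M \<omega> n x \<noteq> 0} \<subseteq> N"
      by (auto simp: eventually_ae_filter)
    then have "negligible N" by (simp add: negligible_iff_null_sets null_sets_completionI)
    then show ?thesis by (rule negligible_subset) (use N(2) in \<open>auto simp: indicator_def\<close>)
  qed
  have "negligible (cmap \<kappa> ` (U \<inter> A n))" for n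
  proof (cases "A n = {}")
    case False
    note An = An[OF this]
    \<comment> \<open>A differentiable map between spaces of equal dimension preserves null sets;
      this takes the place of a change of variables.\<close>
    have "negligible ((\<lambda>x. cmap \<kappa> (cinv (K n) x)) ` (cmap (K n) ` (U \<inter> A n)))"
    proof (rule negligible_differentiable_image_negligible)
      show "negligible (cmap (K n) ` (U \<inter> A n))"
      proof (rule negligible_subset[OF neg[of n]])
        show "cmap (K n) ` (U \<inter> A n) \<subseteq> {x \<in> piece M n. local_density M \<omega> n x \<noteq> 0}"
        proof
          fix x assume "x \<in> cmap (K n) ` (U \<inter> A n)"
          then obtain p where p: "x = cmap (K n) p" "p \<in> U" "p \<in> A n" by auto
          then have "p \<in> cdom (K n)" using An(2) by blast
          then have "cinv (K n) x = p" "\<omega> (K n) p coordinate_frame > 0"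
            using p An(1) cinv_cmap pos by blast+
          then have "local_density M \<omega> n x \<noteq> 0" unfolding ld by simp
          then show "x \<in> {x \<in> piece M n. local_density M \<omega> n x \<noteq> 0}"
            using p unfolding pc by blast
        qed
      qed
      show "(\<lambda>x. cmap \<kappa> (cinv (K n) x)) differentiable_on (cmap (K n) ` (U \<inter> A n))"
        unfolding differentiable_on_def
      proof
        fix x assume "x \<in> cmap (K n) ` (U \<inter> A n)"
        then obtain p where p: "x = cmap (K n) p" "p \<in> cdom \<kappa>" "p \<in> cdom (K n)" using U An(2) by blast
        show "(\<lambda>x. cmap \<kappa> (cinv (K n) x)) differentiable (at x within cmap (K n) ` (U \<inter> A n))"
          unfolding p(1)
          by (rule differentiableI, rule has_derivative_subset[OF transition_has_derivative[OF An(1) \<kappa> p(3,2)]])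
             (use U An(2) in \<open>unfold overlap_def, blast\<close>)
      qed
    qed auto
    moreover have "(\<lambda>x. cmap \<kappa> (cinv (K n) x)) ` (cmap (K n) ` (U \<inter> A n)) = cmap \<kappa> ` (U \<inter> A n)"
    proof -
      have "cmap \<kappa> (cinv (K n) (cmap (K n) q)) = cmap \<kappa> q" if "q \<in> U \<inter> A n" for q
        using cinv_cmap[OF An(1), of q] An(2) that by auto
      then show ?thesis unfolding image_image by (intro image_cong) auto
    qed
    ultimately show ?thesis by simp
  qed simp
  then have "negligible (\<Union>n. cmap \<kappa> ` (U \<inter> A n))" by (intro negligible_Union_nat)
  moreover have "cmap \<kappa> ` U = (\<Union>n. cmap \<kappa> ` (U \<inter> A n))"
  proof -
    have "(\<Union>n. A n) = points M" using KA(2) by (simp add: chart_partition_def)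
    then have "U = (\<Union>n. U \<inter> A n)" using U cdom_subset[OF \<kappa>] by blast
    then show ?thesis by (metis image_UN)
  qed
  ultimately show ?thesis by simp
qed

text \<open>The sign in \<open>covector\<close> cancels the sign of a field of parity
  \<open>\<tau>\<close>, so \<open>a \<kappa> p \<bullet> V \<kappa> p\<close> is an ordinary scalar
  for both parities. A suitable bump field makes it nonnegative everywhere and positive on a ball,
  and no ball is negligible.\<close>

lemma fundamental_lemma:
  assumes covector: "\<And>\<kappa> \<kappa>' p u. \<kappa> \<in> atlas M \<Longrightarrow> \<kappa>' \<in> atlas M \<Longrightarrow> p \<in> cdom \<kappa> \<Longrightarrow> p \<in> cdom \<kappa>' \<Longrightarrow>
      a \<kappa> p \<bullet> u = orientation_factor \<tau> (jacobian \<kappa> \<kappa>' p) * (a \<kappa>' p \<bullet> (jacobian \<kappa> \<kappa>' p *v u))"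
    and cont: "\<And>\<kappa>. \<kappa> \<in> atlas M \<Longrightarrow> continuous_on (cimg \<kappa>) (\<lambda>x. a \<kappa> (cinv \<kappa> x))"
    and vanish: "\<And>V K. V \<in> vector_fields M \<tau> \<Longrightarrow> compact K \<Longrightarrow> K \<subseteq> interior_points M \<Longrightarrow>
      (\<And>\<kappa> p. p \<notin> K \<Longrightarrow> V \<kappa> p = 0) \<Longrightarrow>
      form_integrable M (vol_density M (\<lambda>\<kappa> p. a \<kappa> p \<bullet> V \<kappa> p)) \<and>
      form_integral M (vol_density M (\<lambda>\<kappa> p. a \<kappa> p \<bullet> V \<kappa> p)) = 0"
    and \<kappa>: "\<kappa> \<in> atlas M" and p: "p \<in> cdom \<kappa>"
  shows "a \<kappa> p = 0"
proof -
  have interior: "a \<kappa> (cinv \<kappa> x) = 0" if x: "x \<in> interior (cimg \<kappa>)" for x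
  proof (rule ccontr)
    \<comment> \<open>Testing along the value of \<open>a\<close> itself makes the pairing
      \<open>u \<bullet> u\<close> at \<open>x\<close>, hence positive on a whole ball around
      it.\<close>
    define u where "u = a \<kappa> (cinv \<kappa> x)"
    assume "a \<kappa> (cinv \<kappa> x) \<noteq> 0"
    then have "u \<bullet> u > 0" by (simp add: u_def)
    have "continuous_on (interior (cimg \<kappa>)) (\<lambda>y. a \<kappa> (cinv \<kappa> y) \<bullet> u)"
      using cont[OF \<kappa>] interior_subset continuous_on_subset by (blast intro: continuous_on_inner continuous_on_const)
    then have "open (interior (cimg \<kappa>) \<inter> (\<lambda>y. a \<kappa> (cinv \<kappa> y) \<bullet> u) -` {0<..})"
      by (intro continuous_open_preimage) auto
    moreover have "x \<in> interior (cimg \<kappa>) \<inter> (\<lambda>y. a \<kappa> (cinv \<kappa> y) \<bullet> u) -` {0<..}"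
      using x \<open>u \<bullet> u > 0\<close> by (simp add: u_def)
    ultimately obtain r where r: "r > 0"
      "cball x r \<subseteq> interior (cimg \<kappa>) \<inter> (\<lambda>y. a \<kappa> (cinv \<kappa> y) \<bullet> u) -` {0<..}"
      by (meson open_contains_cball)
    have rc: "cball x r \<subseteq> cimg \<kappa>" using r(2) interior_subset by blast
    let ?V = "bump_field \<tau> \<kappa> x r u"
    let ?\<omega> = "vol_density M (\<lambda>\<kappa>' p. a \<kappa>' p \<bullet> ?V \<kappa>' p)"
    have aV: "a \<kappa>' q \<bullet> ?V \<kappa>' q = (if q \<in> cdom \<kappa> then bump x r (cmap \<kappa> q) * (a \<kappa> q \<bullet> u) else 0)"
      if "\<kappa>' \<in> atlas M" "q \<in> cdom \<kappa>'" for \<kappa>' q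
      using that covector[OF \<kappa> that(1) _ that(2), of u] by (auto simp: bump_field_def)
    have pos: "bump x r (cmap \<kappa> q) * (a \<kappa> q \<bullet> u) > 0" if "q \<in> cdom \<kappa>" "cmap \<kappa> q \<in> ball x r" for q
    proof -
      have "cmap \<kappa> q \<in> cball x r" using that(2) by auto
      then have "a \<kappa> (cinv \<kappa> (cmap \<kappa> q)) \<bullet> u > 0" using r(2) by blast
      then show ?thesis using bump_pos[OF that(2)] \<kappa> that(1) by (simp add: cinv_cmap)
    qed
    have "negligible (cmap \<kappa> ` (cinv \<kappa> ` ball x r))"
    proof (rule nonneg_form_integral_zero_negligible[OF \<kappa>, of ?\<omega>])
      have "form_integrable M ?\<omega> \<and> form_integral M ?\<omega> = 0"
      proof (rule vanish)
        show "?V \<in> vector_fields M \<tau>" using bump_field_vector_field[OF \<kappa> r(1) rc] .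
        show "compact (cinv \<kappa> ` cball x r)" using compact_cinv_cball[OF \<kappa> rc] .
        show "cinv \<kappa> ` cball x r \<subseteq> interior_points M" using cinv_interior_points[OF \<kappa>] r(2) by blast
      qed (rule bump_field_zero[OF \<kappa> r(1)])
      then show "form_integrable M ?\<omega>" "form_integral M ?\<omega> = 0" by auto
      show "cinv \<kappa> ` ball x r \<subseteq> cdom \<kappa>" using cinv_in_cdom[OF \<kappa>] rc ball_subset_cball by blast
    next
      fix \<kappa>' q assume q: "\<kappa>' \<in> atlas M" "q \<in> cdom \<kappa>'"
      have "a \<kappa>' q \<bullet> ?V \<kappa>' q \<ge> 0"
        using aV[OF q] pos[of q] bump_zero[OF r(1), of "cmap \<kappa> q"] by (cases "cmap \<kappa> q \<in> ball x r") auto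
      then show "?\<omega> \<kappa>' q coordinate_frame \<ge> 0"
        using det_metric_pos[OF q] by (simp add: vol_density_def vol_coordinate_frame)
      assume "q \<in> cinv \<kappa> ` ball x r"
      then obtain y where y: "y \<in> ball x r" "q = cinv \<kappa> y" by auto
      then have "y \<in> cimg \<kappa>" using rc by auto
      then have "a \<kappa>' q \<bullet> ?V \<kappa>' q > 0"
        using y aV[OF q] pos[of q] \<kappa> cinv_in_cdom[OF \<kappa>] by (simp add: cmap_cinv)
      then show "?\<omega> \<kappa>' q coordinate_frame > 0"
        using det_metric_pos[OF q] by (simp add: vol_density_def vol_coordinate_frame)
    qed
    moreover have "cmap \<kappa> ` (cinv \<kappa> ` ball x r) = ball x r"
      unfolding image_image using cmap_cinv[OF \<kappa>] rc by (force simp: subset_iff)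
    ultimately show False using open_not_negligible[of "ball x r"] r(1) by auto
  qed
  show ?thesis
  proof (rule ccontr)
    assume nz: "a \<kappa> p \<noteq> 0"
    define T where "T = cimg \<kappa> \<inter> (\<lambda>x. a \<kappa> (cinv \<kappa> x)) -` (- {0})"
    have "openin (top_of_set (cimg \<kappa>)) T"
      unfolding T_def by (rule continuous_openin_preimage_gen[OF cont[OF \<kappa>]]) auto
    then have "half_space_open T" using half_space_open_openin cimg_half_space_open[OF \<kappa>] by blast
    moreover have "cmap \<kappa> p \<in> T" using nz p \<kappa> by (simp add: T_def cinv_cmap)
    ultimately obtain e where e: "e > 0" "\<And>y. dist y (cmap \<kappa> p) < e \<Longrightarrow> cmap \<kappa> p $ 1 \<le> y $ 1 \<Longrightarrow> y \<in> T"
      using half_space_openE by blast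
    \<comment> \<open>Moving inward by \<open>e / 2\<close> leaves room for a full ball of radius
      \<open>e / 2\<close>: it stays within distance \<open>e\<close> of
      \<open>cmap \<kappa> p\<close> and on the inward side.\<close>
    define y where "y = cmap \<kappa> p + (e / 2) *\<^sub>R axis 1 1"
    have yd: "dist y (cmap \<kappa> p) = e / 2" using e(1) by (simp add: y_def dist_norm)
    have "ball y (e / 2) \<subseteq> T"
    proof
      fix z assume z: "z \<in> ball y (e / 2)"
      then have "dist z y < e / 2" by (simp add: dist_commute)
      then have "dist z (cmap \<kappa> p) < e" using yd dist_triangle[of z "cmap \<kappa> p" y] by linarith
      moreover have "\<bar>(z - y) $ 1\<bar> \<le> norm (z - y)" by (rule component_le_norm_cart)
      then have "cmap \<kappa> p $ 1 \<le> z $ 1" using \<open>dist z y < e / 2\<close> by (simp add: dist_norm y_def)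
      ultimately show "z \<in> T" by (rule e(2))
    qed
    then have "y \<in> interior (cimg \<kappa>)"
      using e(1) by (auto simp: mem_interior T_def intro!: exI[of _ "e / 2"])
    moreover have "y \<in> T" using \<open>ball y (e / 2) \<subseteq> T\<close> e(1) by auto
    ultimately show False using interior by (auto simp: T_def)
  qed
qed

end

section \<open>Pointwise exterior algebra in dimension three\<close>

text \<open>Taking the three values of the permutation as arguments makes this fit a wedge with
  either splitting of the slots; the first three terms are the even permutations.\<close>

lemma sum_permutes_3:
  fixes f :: "nat \<Rightarrow> nat \<Rightarrow> nat \<Rightarrow> real"
  shows "(\<Sum>\<sigma> | \<sigma> permutes {..<3}. of_int (sign \<sigma>) * f (\<sigma> 0) (\<sigma> 1) (\<sigma> 2)) =
    f 0 1 2 + f 1 2 0 + f 2 0 1 - f 0 2 1 - f 1 0 2 - f 2 1 0"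
proof -
  have e: "{..<3} = {0::nat, 1, 2}" by auto
  have f: "finite {1::nat, 2}" "0 \<notin> {1::nat, 2}" "finite {2::nat}" "1 \<notin> {2::nat}" by auto
  show ?thesis
    unfolding e sum_over_permutations_insert[OF f(1,2)] sum_over_permutations_insert[OF f(3,4)] permutes_sing
    by (simp add: sign_swap_id permutation_swap_id sign_compose sign_id transpose_def)
qed

lemma coordinate_frame_simps:
  "coordinate_frame 0 = axis 1 1" "coordinate_frame 1 = axis 2 1" "coordinate_frame 2 = axis 3 1"
  by (simp_all add: coordinate_frame_def)

lemma case_nat_simps: "case_nat a v 0 = a" "case_nat a v (1::nat) = v 0" "case_nat a v (2::nat) = v 1"
  by (simp_all add: numeral_2_eq_2)

text \<open>The 4-form \<open>\<omega> \<and> vol\<close> vanishes in dimension three, and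
  contracting it with \<open>V\<close> leaves
  \<open>\<omega>(V) vol = \<omega> \<and> i_V vol\<close>; the proof checks this on the frame. The
  hypotheses are pointwise so that \<open>\<eta>\<close> may be a form known to be a contraction
  only inside charts, such as an exterior derivative.\<close>

lemma
  assumes \<omega>: "\<And>v. \<omega> \<kappa> p v = u \<bullet> v 0"
    and \<eta>: "\<And>v. \<eta> \<kappa> p v = int_prod V (vol M) \<kappa> p v"
  shows wedge_1_2_vol: "wedge 1 2 \<omega> \<eta> \<kappa> p coordinate_frame
      = vol_density M (\<lambda>\<kappa> p. u \<bullet> V \<kappa> p) \<kappa> p coordinate_frame"
    and wedge_2_1_vol: "wedge 2 1 \<eta> \<omega> \<kappa> p coordinate_frame
      = vol_density M (\<lambda>\<kappa> p. u \<bullet> V \<kappa> p) \<kappa> p coordinate_frame"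
proof -
  define s where "s = sqrt (det (metric M \<kappa> p))"
  define W where "W a b = s * det (vector [V \<kappa> p, a, b] :: real^3^3)" for a b
  have \<eta>': "\<eta> \<kappa> p v = W (v 0) (v 1)" for v
    by (simp add: \<eta> int_prod_def vol_def W_def s_def case_nat_simps del: One_nat_def)
  let ?e = coordinate_frame
  have n: "(1::nat) + 2 = 3" "(2::nat) + 1 = 3" "(1::nat) + 0 = 1" "(1::nat) + 1 = 2" "(2::nat) + 0 = 2"
    "fact (1::nat) * fact (2::nat) = (2::real)" "fact (2::nat) * fact (1::nat) = (2::real)"
    by (simp_all add: fact_numeral)
  \<comment> \<open>The contracted volume form returns the components of \<open>V\<close> times
    \<open>s\<close>. Each basis pair occurs in both orders with equal contributions, which cancels
    the factor 2 of the normalization.\<close>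
  have W: "W (axis 2 1) (axis 3 1) = s * V \<kappa> p $ 1" "W (axis 3 1) (axis 2 1) = - (s * V \<kappa> p $ 1)"
    "W (axis 3 1) (axis 1 1) = s * V \<kappa> p $ 2" "W (axis 1 1) (axis 3 1) = - (s * V \<kappa> p $ 2)"
    "W (axis 1 1) (axis 2 1) = s * V \<kappa> p $ 3" "W (axis 2 1) (axis 1 1) = - (s * V \<kappa> p $ 3)"
    by (simp_all add: W_def s_def det_3 axis_def)
  have vd: "vol_density M (\<lambda>\<kappa> p. u \<bullet> V \<kappa> p) \<kappa> p ?e
    = (u $ 1 * V \<kappa> p $ 1 + u $ 2 * V \<kappa> p $ 2 + u $ 3 * V \<kappa> p $ 3) * s"
    by (simp add: vol_density_def vol_coordinate_frame s_def inner_vec_def sum_3)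
  have "wedge 1 2 \<omega> \<eta> \<kappa> p ?e = (\<Sum>\<sigma> | \<sigma> permutes {..<3}.
      of_int (sign \<sigma>) * (u \<bullet> ?e (\<sigma> 0) * W (?e (\<sigma> 1)) (?e (\<sigma> 2)))) / 2"
    unfolding wedge_def \<omega> \<eta>' n by (simp only: mult.assoc)
  then show "wedge 1 2 \<omega> \<eta> \<kappa> p ?e = vol_density M (\<lambda>\<kappa> p. u \<bullet> V \<kappa> p) \<kappa> p ?e"
    unfolding sum_permutes_3[of "\<lambda>i j k. u \<bullet> ?e i * W (?e j) (?e k)"] coordinate_frame_simps W vd
    by (simp add: inner_axis algebra_simps)
  have "wedge 2 1 \<eta> \<omega> \<kappa> p ?e = (\<Sum>\<sigma> | \<sigma> permutes {..<3}.
      of_int (sign \<sigma>) * (W (?e (\<sigma> 0)) (?e (\<sigma> 1)) * (u \<bullet> ?e (\<sigma> 2)))) / 2"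
    unfolding wedge_def \<omega> \<eta>' n by (simp only: mult.assoc)
  then show "wedge 2 1 \<eta> \<omega> \<kappa> p ?e = vol_density M (\<lambda>\<kappa> p. u \<bullet> V \<kappa> p) \<kappa> p ?e"
    unfolding sum_permutes_3[of "\<lambda>i j k. W (?e i) (?e j) * (u \<bullet> ?e k)"] coordinate_frame_simps W vd
    by (simp add: inner_axis algebra_simps)
qed

lemma int_prod_vol_linear:
  "int_prod (\<lambda>\<kappa> p. U \<kappa> p + c *\<^sub>R V \<kappa> p) (vol M) =
   (\<lambda>\<kappa> p v. int_prod U (vol M) \<kappa> p v + c * int_prod V (vol M) \<kappa> p v)"
  by (simp add: fun_eq_iff int_prod_def vol_def det_3 algebra_simps)

text \<open>In dimension three an antisymmetric matrix has three free entries, as many as a vector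
  has components. With \<open>A\<close> the matrix of partial derivatives of a covector field, the
  left side is its exterior derivative.\<close>

lemma alternating_bilinear_eq_int_prod_vol:
  fixes A :: "real^3^3"
  assumes "det (metric M \<kappa> p) > 0"
  shows "\<exists>c. \<forall>v. v 1 \<bullet> (A *v v 0) - v 0 \<bullet> (A *v v 1) = vol M \<kappa> p (case_nat c v)"
proof -
  define s where "s = sqrt (det (metric M \<kappa> p))"
  have s: "s \<noteq> 0" using assms by (simp add: s_def)
  \<comment> \<open>The coordinate formula of the curl: differences of opposite entries of
    \<open>A\<close>, divided by the volume factor.\<close>
  define c :: "real^3" where
    "c = (1 / s) *\<^sub>R vector [A $ 3 $ 2 - A $ 2 $ 3, A $ 1 $ 3 - A $ 3 $ 1, A $ 2 $ 1 - A $ 1 $ 2]"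
  have "v 1 \<bullet> (A *v v 0) - v 0 \<bullet> (A *v v 1) = vol M \<kappa> p (case_nat c v)" for v
  proof -
    have sc: "s * c $ 1 = A $ 3 $ 2 - A $ 2 $ 3" "s * c $ 2 = A $ 1 $ 3 - A $ 3 $ 1"
      "s * c $ 3 = A $ 2 $ 1 - A $ 1 $ 2"
      using s by (simp_all add: c_def)
    let ?a = "v 0" and ?b = "v 1"
    have "vol M \<kappa> p (case_nat c v) = s * c $ 1 * (?a $ 2 * ?b $ 3 - ?a $ 3 * ?b $ 2)
        + s * c $ 2 * (?a $ 3 * ?b $ 1 - ?a $ 1 * ?b $ 3) + s * c $ 3 * (?a $ 1 * ?b $ 2 - ?a $ 2 * ?b $ 1)"
      unfolding vol_def s_def[symmetric] case_nat_simps by (simp add: det_3 algebra_simps del: One_nat_def)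
    then show ?thesis
      unfolding sc by (simp add: inner_vec_def matrix_vector_mult_def sum_3 algebra_simps)
  qed
  then show ?thesis by blast
qed

section \<open>One-forms and their component vectors\<close>

definition covec :: "'a dform \<Rightarrow> 'a vfield" where
  "covec \<omega> \<kappa> p = (\<chi> i. \<omega> \<kappa> p (\<lambda>_. axis i 1))"

lemma one_form_covec:
  assumes "\<omega> \<in> diff_forms M \<tau> 1" "\<kappa> \<in> atlas M" "p \<in> cdom \<kappa>"
  shows "\<omega> \<kappa> p v = covec \<omega> \<kappa> p \<bullet> v 0"
proof -
  have alt: "alternating_multilinear 1 (\<omega> \<kappa> p)" using assms by (auto simp: diff_forms_def)
  define f where "f u = \<omega> \<kappa> p ((\<lambda>_. 0)(0 := u))" for u
  have lin: "linear f"
    using alt unfolding alternating_multilinear_def f_def by blast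
  have dep: "\<omega> \<kappa> p v = \<omega> \<kappa> p w" if "v 0 = w 0" for v w
  proof -
    have "\<forall>i<1. v i = w i" using that by simp
    then show ?thesis using alt unfolding alternating_multilinear_def by blast
  qed
  have "\<omega> \<kappa> p v = f (v 0)" unfolding f_def by (rule dep) simp
  also have "\<dots> = f (\<Sum>i\<in>UNIV. v 0 $ i *\<^sub>R axis i 1)"
    using basis_expansion[of "v 0"] by (simp add: scalar_mult_eq_scaleR)
  also have "\<dots> = (\<Sum>i\<in>UNIV. v 0 $ i *\<^sub>R f (axis i 1))"
    by (simp only: linear_sum[OF lin] linear_scale[OF lin])
  also have "\<dots> = (\<Sum>i\<in>UNIV. v 0 $ i * covec \<omega> \<kappa> p $ i)"
  proof (intro sum.cong refl)
    fix i :: 3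
    \<comment> \<open>\<open>covec\<close> repeats the basis vector in every slot while
      \<open>f\<close> fills the rest with zero; a 1-form reads slot 0 alone.\<close>
    have "f (axis i 1) = \<omega> \<kappa> p (\<lambda>_. axis i 1)" unfolding f_def by (rule dep) simp
    then show "v 0 $ i *\<^sub>R f (axis i 1) = v 0 $ i * covec \<omega> \<kappa> p $ i" by (simp add: covec_def)
  qed
  finally show ?thesis by (simp add: inner_vec_def mult.commute)
qed

text \<open>Membership of \<open>x\<close> in \<open>S\<close> matters, since a derivative within
  \<open>S\<close> also involves the value at \<open>x\<close> itself.\<close>

lemma frechet_derivative_cong_within:
  assumes "x \<in> S" "\<And>y. y \<in> S \<Longrightarrow> f y = g y"
  shows "frechet_derivative f (at x within S) = frechet_derivative g (at x within S)"
proof -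
  have "(f has_derivative f') (at x within S) \<longleftrightarrow> (g has_derivative f') (at x within S)" for f'
    using has_derivative_transform[OF assms(1), of f g] has_derivative_transform[OF assms(1), of g f] assms(2)
    by auto
  then show ?thesis by (simp add: frechet_derivative_def)
qed

section \<open>Flats and curls of vector fields\<close>

context riemannian_manifold3
begin

lemma metric_symmetric:
  assumes "\<kappa> \<in> atlas M" "p \<in> cdom \<kappa>"
  shows "u \<bullet> (metric M \<kappa> p *v w) = (metric M \<kappa> p *v u) \<bullet> w"
proof -
  have "transpose (metric M \<kappa> p) = metric M \<kappa> p"
    using manifold assms unfolding riemannian_3_manifold_def by blast
  then have "u v* metric M \<kappa> p = metric M \<kappa> p *v u" using transpose_matrix_vector[of "metric M \<kappa> p" u] by simp
  then show ?thesis using dot_lmul_matrix[of u "metric M \<kappa> p" w] by simp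
qed

lemma flat_smooth:
  assumes "V \<in> vector_fields M \<tau>" "\<kappa> \<in> atlas M"
  shows "Ck_on k (cimg \<kappa>) (\<lambda>x. (metric M \<kappa> (cinv \<kappa> x) *v V \<kappa> (cinv \<kappa> x)) $ i)"
proof -
  have "Ck_on k (cimg \<kappa>) (\<lambda>x. metric M \<kappa> (cinv \<kappa> x) $ i $ j)" for j
    using manifold assms(2) unfolding riemannian_3_manifold_def smooth_on_def by blast
  moreover have "Ck_on k (cimg \<kappa>) (\<lambda>x. V \<kappa> (cinv \<kappa> x) $ j)" for j
    using assms unfolding vector_fields_def smooth_on_def by blast
  ultimately show ?thesis
    unfolding matrix_vector_mult_def vec_lambda_beta by (intro Ck_on_sum Ck_on_mult)
qed

text \<open>The metric law supplies one Jacobian for each argument. The field \<open>V\<close>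
  brings in a sign, which the sign in front offsets since its square is one.\<close>

lemma flat_covector:
  assumes "V \<in> vector_fields M \<tau>" "\<kappa> \<in> atlas M" "\<kappa>' \<in> atlas M" "p \<in> cdom \<kappa>" "p \<in> cdom \<kappa>'"
  shows "(metric M \<kappa> p *v V \<kappa> p) \<bullet> u = orientation_factor \<tau> (jacobian \<kappa> \<kappa>' p) *
    ((metric M \<kappa>' p *v V \<kappa>' p) \<bullet> (jacobian \<kappa> \<kappa>' p *v u))"
proof -
  let ?J = "jacobian \<kappa> \<kappa>' p" and ?o = "orientation_factor \<tau> (jacobian \<kappa> \<kappa>' p)"
  have V: "V \<kappa>' p = ?o *\<^sub>R (?J *v V \<kappa> p)" using assms unfolding vector_fields_def by blast
  have "(metric M \<kappa> p *v V \<kappa> p) \<bullet> u = (metric M \<kappa>' p *v (?J *v V \<kappa> p)) \<bullet> (?J *v u)"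
    unfolding metric_transform[OF assms(2-5)] matrix_vector_mul_assoc[symmetric] transpose_matrix_vector
    by (rule dot_lmul_matrix)
  also have "\<dots> = (?o * ?o) * ((metric M \<kappa>' p *v (?J *v V \<kappa> p)) \<bullet> (?J *v u))"
    using orientation_factor_square[OF det_jacobian_nonzero[OF assms(2-5)]] by simp
  finally show ?thesis by (simp add: V matrix_vector_mult_scaleR)
qed

text \<open>\<open>curl\<close> is chosen by \<open>SOME\<close>, so existence is what has to be
  shown. The defining equation is imposed separately at each chart and point, hence pointwise
  solutions assemble by choice.\<close>

lemma curl_ext_deriv:
  assumes V: "V \<in> vector_fields M \<tau>" and \<kappa>: "\<kappa> \<in> atlas M" and p: "p \<in> cdom \<kappa>"
  shows "ext_deriv 1 (flat M V) \<kappa> p = int_prod (curl M V) (vol M) \<kappa> p"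
proof -
  have "\<exists>c. ext_deriv 1 (flat M V) \<kappa> p = (\<lambda>v. vol M \<kappa> p (case_nat c v))"
    if \<kappa>: "\<kappa> \<in> atlas M" and p: "p \<in> cdom \<kappa>" for \<kappa> p
  proof -
    let ?m = "\<lambda>x. metric M \<kappa> (cinv \<kappa> x) *v V \<kappa> (cinv \<kappa> x)" and ?at = "at (cmap \<kappa> p) within cimg \<kappa>"
    have x: "cmap \<kappa> p \<in> cimg \<kappa>" using p by auto
    have "\<forall>i. \<exists>g. ((\<lambda>x. ?m x $ i) has_derivative (\<lambda>h. g \<bullet> h)) ?at"
    proof
      fix i show "\<exists>g. ((\<lambda>x. ?m x $ i) has_derivative (\<lambda>h. g \<bullet> h)) ?at"
        using flat_smooth[OF V \<kappa>, of "Suc 0" i] x unfolding Ck_on.simps by blast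
    qed
    from choice[OF this] obtain g where g: "\<forall>i. ((\<lambda>x. ?m x $ i) has_derivative (\<lambda>h. g i \<bullet> h)) ?at" ..
    have m: "(?m has_derivative (\<lambda>h. \<chi> i. g i \<bullet> h)) ?at"
      by (rule has_derivative_vec_componentwise) (rule g[rule_format])
    \<comment> \<open>The partial derivatives of the flat, one row for each of its
      components.\<close>
    define A where "A = (\<chi> i. g i)"
    have A: "(\<chi> i. g i \<bullet> h) = A *v h" for h
      by (simp add: A_def matrix_vector_mult_def inner_vec_def vec_eq_iff)
    have "frechet_derivative (\<lambda>x. w \<bullet> ?m x) ?at = (\<lambda>h. w \<bullet> (A *v h))" for w
    proof -
      have "((\<lambda>x. w \<bullet> ?m x) has_derivative (\<lambda>h. w \<bullet> (A *v h))) ?at"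
        using has_derivative_inner_right[OF m] by (simp add: A)
      moreover from this have "((\<lambda>x. w \<bullet> ?m x) has_derivative frechet_derivative (\<lambda>x. w \<bullet> ?m x) ?at) ?at"
        using differentiableI frechet_derivative_works by blast
      ultimately show ?thesis
        by (intro half_space_open_derivative_unique[OF cimg_half_space_open[OF \<kappa>] x])
    qed
    note fd = this
    have ext_eq: "ext_deriv 1 (flat M V) \<kappa> p v = v 1 \<bullet> (A *v v 0) - v 0 \<bullet> (A *v v 1)" for v
    proof -
      have "{..1::nat} = {0, 1}" by auto
      then show ?thesis by (simp add: ext_deriv_def flat_def omit_def fd)
    qed
    obtain c where "\<And>v. v 1 \<bullet> (A *v v 0) - v 0 \<bullet> (A *v v 1) = vol M \<kappa> p (case_nat c v)"
      using alternating_bilinear_eq_int_prod_vol[OF det_metric_pos[OF \<kappa> p], of A] by blast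
    then show ?thesis by (intro exI[of _ c] ext) (simp only: ext_eq)
  qed
  then have "\<forall>\<kappa>\<in>atlas M. \<forall>p\<in>cdom \<kappa>. \<exists>c. ext_deriv 1 (flat M V) \<kappa> p = (\<lambda>v. vol M \<kappa> p (case_nat c v))"
    by blast
  then obtain C where C: "\<forall>\<kappa>\<in>atlas M. \<forall>p\<in>cdom \<kappa>.
      ext_deriv 1 (flat M V) \<kappa> p = (\<lambda>v. vol M \<kappa> p (case_nat (C \<kappa> p) v))"
    unfolding bchoice_iff by blast
  then have "\<exists>C. \<forall>\<kappa>\<in>atlas M. \<forall>p\<in>cdom \<kappa>. ext_deriv 1 (flat M V) \<kappa> p = int_prod C (vol M) \<kappa> p"
    unfolding int_prod_def by blast
  from someI_ex[OF this] show ?thesis using \<kappa> p unfolding curl_def by blast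
qed

text \<open>The difference of the two covectors transforms with parity \<open>\<tau>\<close> and
  integrates to zero against every test field. Integrability is carried along because integrals are
  subtracted only for integrable densities.\<close>

lemma one_form_eq_flat:
  assumes \<omega>: "\<omega> \<in> diff_forms M \<tau> 1" and V: "V \<in> vector_fields M \<tau>"
    and eq: "\<And>W K. W \<in> vector_fields M \<tau> \<Longrightarrow> compact K \<Longrightarrow> K \<subseteq> interior_points M \<Longrightarrow>
      (\<And>\<kappa> p. p \<notin> K \<Longrightarrow> W \<kappa> p = 0) \<Longrightarrow>
      form_integrable M (vol_density M (\<lambda>\<kappa> p. covec \<omega> \<kappa> p \<bullet> W \<kappa> p)) \<and>
      form_integrable M (vol_density M (g_inner M V W)) \<and>
      form_integral M (vol_density M (\<lambda>\<kappa> p. covec \<omega> \<kappa> p \<bullet> W \<kappa> p))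
        = form_integral M (vol_density M (g_inner M V W))"
    and \<kappa>: "\<kappa> \<in> atlas M" and p: "p \<in> cdom \<kappa>"
  shows "covec \<omega> \<kappa> p = metric M \<kappa> p *v V \<kappa> p"
proof -
  define a where "a \<kappa> p = covec \<omega> \<kappa> p - metric M \<kappa> p *v V \<kappa> p" for \<kappa> p
  have "a \<kappa> p = 0"
  proof (rule fundamental_lemma[OF _ _ _ \<kappa> p, of a \<tau>])
    fix \<kappa> \<kappa>' p u assume k: "\<kappa> \<in> atlas M" "\<kappa>' \<in> atlas M" "p \<in> cdom \<kappa>" "p \<in> cdom \<kappa>'"
    have "covec \<omega> \<kappa> p \<bullet> u = \<omega> \<kappa> p (\<lambda>_. u)" using one_form_covec[OF \<omega> k(1,3)] by simp
    also have "\<dots> = orientation_factor \<tau> (jacobian \<kappa> \<kappa>' p) * \<omega> \<kappa>' p (\<lambda>i. jacobian \<kappa> \<kappa>' p *v u)"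
      using \<omega> k unfolding diff_forms_def by blast
    also have "\<omega> \<kappa>' p (\<lambda>i. jacobian \<kappa> \<kappa>' p *v u) = covec \<omega> \<kappa>' p \<bullet> (jacobian \<kappa> \<kappa>' p *v u)"
      using one_form_covec[OF \<omega> k(2,4)] by simp
    finally show "a \<kappa> p \<bullet> u = orientation_factor \<tau> (jacobian \<kappa> \<kappa>' p) * (a \<kappa>' p \<bullet> (jacobian \<kappa> \<kappa>' p *v u))"
      by (simp add: a_def inner_diff_left flat_covector[OF V k] right_diff_distrib)
  next
    fix \<kappa> assume k: "\<kappa> \<in> atlas M"
    have "continuous_on (cimg \<kappa>) (\<lambda>x. covec \<omega> \<kappa> (cinv \<kappa> x))"
      unfolding covec_def
    proof (intro continuous_on_vec_lambda)
      show "continuous_on (cimg \<kappa>) (\<lambda>x. \<omega> \<kappa> (cinv \<kappa> x) (\<lambda>_. axis i 1))" for i :: 3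
        using \<omega> k Ck_on_continuous unfolding diff_forms_def smooth_on_def by blast
    qed
    moreover have "continuous_on (cimg \<kappa>) (\<lambda>x. \<chi> i. (metric M \<kappa> (cinv \<kappa> x) *v V \<kappa> (cinv \<kappa> x)) $ i)"
      by (intro continuous_on_vec_lambda Ck_on_continuous[OF flat_smooth[OF V k]])
    ultimately show "continuous_on (cimg \<kappa>) (\<lambda>x. a \<kappa> (cinv \<kappa> x))"
      unfolding a_def by (intro continuous_on_diff) simp_all
  next
    fix W K assume "W \<in> vector_fields M \<tau>" "compact K" "K \<subseteq> interior_points M"
      "\<And>\<kappa> p. p \<notin> K \<Longrightarrow> W \<kappa> p = 0"
    note W = eq[OF this]
    let ?d = "\<lambda>\<kappa> p v. vol_density M (\<lambda>\<kappa> p. covec \<omega> \<kappa> p \<bullet> W \<kappa> p) \<kappa> p v - vol_density M (g_inner M V W) \<kappa> p v"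
    let ?a = "vol_density M (\<lambda>\<kappa> p. a \<kappa> p \<bullet> W \<kappa> p)"
    have d: "?a \<kappa> p coordinate_frame = ?d \<kappa> p coordinate_frame"
      if "\<kappa> \<in> atlas M" "p \<in> cdom \<kappa>" for \<kappa> p
      using metric_symmetric[OF that]
      by (simp add: vol_density_def a_def g_inner_def inner_diff_left left_diff_distrib)
    have "form_integrable M ?d" "form_integral M ?d = 0"
      using W form_integrable_diff[of M "vol_density M (\<lambda>\<kappa> p. covec \<omega> \<kappa> p \<bullet> W \<kappa> p)" "vol_density M (g_inner M V W)"]
        form_integral_diff[of M "vol_density M (\<lambda>\<kappa> p. covec \<omega> \<kappa> p \<bullet> W \<kappa> p)" "vol_density M (g_inner M V W)"]
      by auto
    then show "form_integrable M (vol_density M (\<lambda>\<kappa> p. a \<kappa> p \<bullet> W \<kappa> p)) \<and>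
      form_integral M (vol_density M (\<lambda>\<kappa> p. a \<kappa> p \<bullet> W \<kappa> p)) = 0"
      using form_integral_cong[where \<omega> = ?a and \<eta> = ?d, OF d] form_integrable_cong[where \<omega> = ?a and \<eta> = ?d, OF d] by simp
  qed
  then show ?thesis by (simp add: a_def)
qed

section \<open>The Poisson bracket\<close>

lemma zero_vector_field: "(\<lambda>\<kappa> p. 0) \<in> vector_fields M \<tau>"
  by (simp add: vector_fields_def smooth_on_def Ck_on_const)

lemma vector_fields_linear:
  assumes "U \<in> vector_fields M \<tau>" "V \<in> vector_fields M \<tau>"
  shows "(\<lambda>\<kappa> p. U \<kappa> p + c *\<^sub>R V \<kappa> p) \<in> vector_fields M \<tau>"
  unfolding vector_fields_def
proof (intro CollectI conjI allI ballI impI)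
  show "U \<kappa> p + c *\<^sub>R V \<kappa> p = 0" if "\<not> (\<kappa> \<in> atlas M \<and> p \<in> cdom \<kappa>)" for \<kappa> p
  proof -
    have "U \<kappa> p = 0" "V \<kappa> p = 0" using assms that unfolding vector_fields_def by blast+
    then show ?thesis by simp
  qed
  show "smooth_on (cimg \<kappa>) (\<lambda>x. (U \<kappa> (cinv \<kappa> x) + c *\<^sub>R V \<kappa> (cinv \<kappa> x)) $ i)" if "\<kappa> \<in> atlas M" for \<kappa> i
  proof -
    have "smooth_on (cimg \<kappa>) (\<lambda>x. U \<kappa> (cinv \<kappa> x) $ i)" "smooth_on (cimg \<kappa>) (\<lambda>x. V \<kappa> (cinv \<kappa> x) $ i)"
      using assms that unfolding vector_fields_def by blast+
    then show ?thesis
      unfolding smooth_on_def vector_add_component vector_scaleR_component real_scaleR_def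
      by (intro allI Ck_on_add Ck_on_mult Ck_on_const) auto
  qed
  fix \<kappa> \<kappa>' p assume "\<kappa> \<in> atlas M" "\<kappa>' \<in> atlas M" "p \<in> cdom \<kappa> \<inter> cdom \<kappa>'"
  then have "U \<kappa>' p = orientation_factor \<tau> (jacobian \<kappa> \<kappa>' p) *\<^sub>R (jacobian \<kappa> \<kappa>' p *v U \<kappa> p)"
    "V \<kappa>' p = orientation_factor \<tau> (jacobian \<kappa> \<kappa>' p) *\<^sub>R (jacobian \<kappa> \<kappa>' p *v V \<kappa> p)"
    using assms unfolding vector_fields_def by blast+
  then show "U \<kappa>' p + c *\<^sub>R V \<kappa>' p
    = orientation_factor \<tau> (jacobian \<kappa> \<kappa>' p) *\<^sub>R (jacobian \<kappa> \<kappa>' p *v (U \<kappa> p + c *\<^sub>R V \<kappa> p))"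
    by (simp add: matrix_vector_right_distrib matrix_vector_mult_scaleR scaleR_add_right mult.commute)
qed

lemma bc_linear:
  assumes "periodic_bc M \<V> \<or> homogeneous_bc M \<V>" "(D, B) \<in> \<V>" "(D', B') \<in> \<V>"
  shows "((\<lambda>\<kappa> p. D \<kappa> p + c *\<^sub>R D' \<kappa> p), (\<lambda>\<kappa> p. B \<kappa> p + c *\<^sub>R B' \<kappa> p)) \<in> \<V>"
  using assms(1)
proof
  assume "periodic_bc M \<V>"
  then have "\<V> = field_pairs M" by (simp add: periodic_bc_def)
  then show ?thesis using assms(2,3) vector_fields_linear by (auto simp: field_pairs_def)
next
  assume "homogeneous_bc M \<V>"
  then have "\<forall>(D, B)\<in>\<V>. \<forall>(D', B')\<in>\<V>. \<forall>a b :: real.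
    ((\<lambda>\<kappa> p. a *\<^sub>R D \<kappa> p + b *\<^sub>R D' \<kappa> p), (\<lambda>\<kappa> p. a *\<^sub>R B \<kappa> p + b *\<^sub>R B' \<kappa> p)) \<in> \<V>"
    unfolding homogeneous_bc_def by blast
  then have "((\<lambda>\<kappa> p. 1 *\<^sub>R D \<kappa> p + c *\<^sub>R D' \<kappa> p), (\<lambda>\<kappa> p. 1 *\<^sub>R B \<kappa> p + c *\<^sub>R B' \<kappa> p)) \<in> \<V>"
    using assms(2,3) by blast
  then show ?thesis by simp
qed

text \<open>Periodic conditions admit all fields. Under homogeneous ones the zero pair is
  admissible, and the given pair agrees with it outside a compact set of interior points.\<close>

lemma bc_compact_support:
  assumes "periodic_bc M \<V> \<or> homogeneous_bc M \<V>"
    and "D \<in> vector_fields M Straight" "B \<in> vector_fields M Twisted"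
    and "compact K" "K \<subseteq> interior_points M" "\<And>\<kappa> p. p \<notin> K \<Longrightarrow> D \<kappa> p = 0 \<and> B \<kappa> p = 0"
  shows "(D, B) \<in> \<V>"
  using assms(1)
proof
  assume "periodic_bc M \<V>"
  then show ?thesis using assms(2,3) by (simp add: periodic_bc_def field_pairs_def)
next
  assume h: "homogeneous_bc M \<V>"
  have zero: "((\<lambda>\<kappa> p. 0), (\<lambda>\<kappa> p. 0)) \<in> \<V>" using h unfolding homogeneous_bc_def by blast
  have "\<forall>(D, B)\<in>\<V>. \<forall>(D', B')\<in>field_pairs M.
        (\<exists>K. compact K \<and> K \<subseteq> interior_points M \<and>
           (\<forall>\<kappa> p. p \<notin> K \<longrightarrow> D' \<kappa> p = D \<kappa> p \<and> B' \<kappa> p = B \<kappa> p))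
        \<longrightarrow> (D', B') \<in> \<V>"
    using h unfolding homogeneous_bc_def by blast
  from bspec[OF this zero] have "\<forall>(D', B')\<in>field_pairs M.
        (\<exists>K. compact K \<and> K \<subseteq> interior_points M \<and> (\<forall>\<kappa> p. p \<notin> K \<longrightarrow> D' \<kappa> p = 0 \<and> B' \<kappa> p = 0))
        \<longrightarrow> (D', B') \<in> \<V>"
    by simp
  moreover have "(D, B) \<in> field_pairs M" using assms(2,3) by (simp add: field_pairs_def)
  ultimately show ?thesis using assms(4-6) by blast
qed

text \<open>\<open>F\<close> and \<open>F'\<close> take the same values along the line of
  variations, because the line stays in \<open>\<V>\<close> and contraction with the volume form is
  linear in the field. A real function has one derivative at zero, so the two integral expressions
  coincide.\<close>

lemma fderivs_agree:
  assumes bc: "periodic_bc M \<V> \<or> homogeneous_bc M \<V>"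
    and F: "\<forall>(D, B)\<in>\<V>. F' (int_prod D (vol M)) (int_prod B (vol M)) = F D B"
    and DB: "(D, B) \<in> \<V>"
    and v: "has_vector_fderivs M \<V> F D B F\<^sub>D F\<^sub>B"
    and f: "has_form_fderivs M \<V> F' (int_prod D (vol M)) (int_prod B (vol M)) F\<^sub>d F\<^sub>b"
    and \<delta>: "(\<delta>D, \<delta>B) \<in> \<V>"
  shows "form_integral M (wedge 1 2 F\<^sub>d (int_prod \<delta>D (vol M))) + form_integral M (wedge 2 1 (int_prod \<delta>B (vol M)) F\<^sub>b)
      = form_integral M (vol_density M (\<lambda>\<kappa> p. g_inner M F\<^sub>D \<delta>D \<kappa> p + g_inner M F\<^sub>B \<delta>B \<kappa> p))"
    and "form_integrable M (wedge 1 2 F\<^sub>d (int_prod \<delta>D (vol M)))"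
    and "form_integrable M (wedge 2 1 (int_prod \<delta>B (vol M)) F\<^sub>b)"
    and "form_integrable M (vol_density M (\<lambda>\<kappa> p. g_inner M F\<^sub>D \<delta>D \<kappa> p + g_inner M F\<^sub>B \<delta>B \<kappa> p))"
proof -
  let ?\<omega> = "vol_density M (\<lambda>\<kappa> p. g_inner M F\<^sub>D \<delta>D \<kappa> p + g_inner M F\<^sub>B \<delta>B \<kappa> p)"
  let ?d = "int_prod \<delta>D (vol M)" and ?b = "int_prod \<delta>B (vol M)"
  have 1: "form_integrable M ?\<omega>"
    "((\<lambda>\<epsilon>. F (\<lambda>\<kappa> p. D \<kappa> p + \<epsilon> *\<^sub>R \<delta>D \<kappa> p) (\<lambda>\<kappa> p. B \<kappa> p + \<epsilon> *\<^sub>R \<delta>B \<kappa> p))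
       has_real_derivative form_integral M ?\<omega>) (at 0)"
    using v \<delta> unfolding has_vector_fderivs_def Let_def by blast+
  have m: "(?d, ?b) \<in> (\<lambda>(\<delta>D, \<delta>B). (int_prod \<delta>D (vol M), int_prod \<delta>B (vol M))) ` \<V>"
    using \<delta> by (rule rev_image_eqI) simp
  have 2: "form_integrable M (wedge 1 2 F\<^sub>d ?d) \<and> form_integrable M (wedge 2 1 ?b F\<^sub>b) \<and>
        ((\<lambda>\<epsilon>. F' (\<lambda>\<kappa> p v. int_prod D (vol M) \<kappa> p v + \<epsilon> * ?d \<kappa> p v)
            (\<lambda>\<kappa> p v. int_prod B (vol M) \<kappa> p v + \<epsilon> * ?b \<kappa> p v))
           has_real_derivative form_integral M (wedge 1 2 F\<^sub>d ?d) + form_integral M (wedge 2 1 ?b F\<^sub>b)) (at 0)"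
    using bspec[OF f[unfolded has_form_fderivs_def, THEN conjunct2, THEN conjunct2] m] by simp
  have "F' (\<lambda>\<kappa> p v. int_prod D (vol M) \<kappa> p v + \<epsilon> * ?d \<kappa> p v) (\<lambda>\<kappa> p v. int_prod B (vol M) \<kappa> p v + \<epsilon> * ?b \<kappa> p v)
      = F (\<lambda>\<kappa> p. D \<kappa> p + \<epsilon> *\<^sub>R \<delta>D \<kappa> p) (\<lambda>\<kappa> p. B \<kappa> p + \<epsilon> *\<^sub>R \<delta>B \<kappa> p)" for \<epsilon>
    using bspec[OF F bc_linear[OF bc DB \<delta>, of \<epsilon>]] by (simp add: int_prod_vol_linear)
  then show "form_integral M (wedge 1 2 F\<^sub>d ?d) + form_integral M (wedge 2 1 ?b F\<^sub>b) = form_integral M ?\<omega>"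
    using DERIV_unique[OF _ 1(2)] 2 by simp
  show "form_integrable M (wedge 1 2 F\<^sub>d ?d)" "form_integrable M (wedge 2 1 ?b F\<^sub>b)" "form_integrable M ?\<omega>"
    using 1 2 by blast+
qed

lemma form_integral_zero_fields:
  shows "form_integral M (wedge 1 2 \<omega> (int_prod (\<lambda>\<kappa> p. 0) (vol M))) = 0"
    and "form_integral M (wedge 2 1 (int_prod (\<lambda>\<kappa> p. 0) (vol M)) \<omega>) = 0"
proof -
  have "int_prod (\<lambda>\<kappa> p. 0) (vol M) = (\<lambda>\<kappa> p v. 0)" by (simp add: fun_eq_iff int_prod_def vol_def det_3)
  then show "form_integral M (wedge 1 2 \<omega> (int_prod (\<lambda>\<kappa> p. 0) (vol M))) = 0"
    "form_integral M (wedge 2 1 (int_prod (\<lambda>\<kappa> p. 0) (vol M)) \<omega>) = 0"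
    by (simp_all add: wedge_def form_integral_def local_density_def set_lebesgue_integral_def
        split: prod.split)
qed

text \<open>A variation with one component zero isolates one functional derivative; the equality of
  sums then becomes the test identity of \<open>one_form_eq_flat\<close>.\<close>

lemma fderivs_flat:
  assumes bc: "periodic_bc M \<V> \<or> homogeneous_bc M \<V>"
    and F: "\<forall>(D, B)\<in>\<V>. F' (int_prod D (vol M)) (int_prod B (vol M)) = F D B"
    and DB: "(D, B) \<in> \<V>"
    and v: "has_vector_fderivs M \<V> F D B F\<^sub>D F\<^sub>B"
    and f: "has_form_fderivs M \<V> F' (int_prod D (vol M)) (int_prod B (vol M)) F\<^sub>d F\<^sub>b"
    and \<kappa>: "\<kappa> \<in> atlas M" and p: "p \<in> cdom \<kappa>"
  shows "covec F\<^sub>d \<kappa> p = metric M \<kappa> p *v F\<^sub>D \<kappa> p" "covec F\<^sub>b \<kappa> p = metric M \<kappa> p *v F\<^sub>B \<kappa> p"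
proof -
  have V: "F\<^sub>D \<in> vector_fields M Straight" "F\<^sub>B \<in> vector_fields M Twisted"
    using v unfolding has_vector_fderivs_def by blast+
  have W: "F\<^sub>d \<in> diff_forms M Straight 1" "F\<^sub>b \<in> diff_forms M Twisted 1"
    using f unfolding has_form_fderivs_def by blast+
  note agree = fderivs_agree[OF bc F DB v f]
  have zero: "g_inner M U (\<lambda>\<kappa> p. 0) \<kappa> p = 0" for U \<kappa> p by (simp add: g_inner_def)
  show "covec F\<^sub>d \<kappa> p = metric M \<kappa> p *v F\<^sub>D \<kappa> p"
  proof (rule one_form_eq_flat[OF W(1) V(1) _ \<kappa> p])
    fix U K assume U: "U \<in> vector_fields M Straight" "compact K" "K \<subseteq> interior_points M"
      "\<And>\<kappa> p. p \<notin> K \<Longrightarrow> U \<kappa> p = 0"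
    have "(U, (\<lambda>\<kappa> p. 0)) \<in> \<V>"
      by (rule bc_compact_support[OF bc U(1) zero_vector_field U(2,3)]) (simp add: U(4))
    note a = agree[OF this, unfolded zero add_0_right form_integral_zero_fields]
    have "wedge 1 2 F\<^sub>d (int_prod U (vol M)) \<kappa> p coordinate_frame
        = vol_density M (\<lambda>\<kappa> p. covec F\<^sub>d \<kappa> p \<bullet> U \<kappa> p) \<kappa> p coordinate_frame"
      if "\<kappa> \<in> atlas M" "p \<in> cdom \<kappa>" for \<kappa> p
      using wedge_1_2_vol[where \<omega> = F\<^sub>d and \<eta> = "int_prod U (vol M)" and \<kappa> = \<kappa> and p = p and u = "covec F\<^sub>d \<kappa> p" and V = U, OF one_form_covec[OF W(1) that] refl] by (simp only: vol_density_def)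
    note cong = form_integral_cong[where \<omega> = "wedge 1 2 F\<^sub>d (int_prod U (vol M))" and \<eta> = "vol_density M (\<lambda>\<kappa> p. covec F\<^sub>d \<kappa> p \<bullet> U \<kappa> p)", OF this]
      form_integrable_cong[where \<omega> = "wedge 1 2 F\<^sub>d (int_prod U (vol M))" and \<eta> = "vol_density M (\<lambda>\<kappa> p. covec F\<^sub>d \<kappa> p \<bullet> U \<kappa> p)", OF this]
    from cong a show "form_integrable M (vol_density M (\<lambda>\<kappa> p. covec F\<^sub>d \<kappa> p \<bullet> U \<kappa> p)) \<and>
      form_integrable M (vol_density M (g_inner M F\<^sub>D U)) \<and>
      form_integral M (vol_density M (\<lambda>\<kappa> p. covec F\<^sub>d \<kappa> p \<bullet> U \<kappa> p))
        = form_integral M (vol_density M (g_inner M F\<^sub>D U))" by simp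
  qed
  show "covec F\<^sub>b \<kappa> p = metric M \<kappa> p *v F\<^sub>B \<kappa> p"
  proof (rule one_form_eq_flat[OF W(2) V(2) _ \<kappa> p])
    fix U K assume U: "U \<in> vector_fields M Twisted" "compact K" "K \<subseteq> interior_points M"
      "\<And>\<kappa> p. p \<notin> K \<Longrightarrow> U \<kappa> p = 0"
    have "((\<lambda>\<kappa> p. 0), U) \<in> \<V>"
      by (rule bc_compact_support[OF bc zero_vector_field U(1,2,3)]) (simp add: U(4))
    note a = agree[OF this, unfolded zero add_0_left form_integral_zero_fields]
    have "wedge 2 1 (int_prod U (vol M)) F\<^sub>b \<kappa> p coordinate_frame
        = vol_density M (\<lambda>\<kappa> p. covec F\<^sub>b \<kappa> p \<bullet> U \<kappa> p) \<kappa> p coordinate_frame"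
      if "\<kappa> \<in> atlas M" "p \<in> cdom \<kappa>" for \<kappa> p
      using wedge_2_1_vol[where \<omega> = F\<^sub>b and \<eta> = "int_prod U (vol M)" and \<kappa> = \<kappa> and p = p and u = "covec F\<^sub>b \<kappa> p" and V = U, OF one_form_covec[OF W(2) that] refl] by (simp only: vol_density_def)
    note cong = form_integral_cong[where \<omega> = "wedge 2 1 (int_prod U (vol M)) F\<^sub>b" and \<eta> = "vol_density M (\<lambda>\<kappa> p. covec F\<^sub>b \<kappa> p \<bullet> U \<kappa> p)", OF this]
      form_integrable_cong[where \<omega> = "wedge 2 1 (int_prod U (vol M)) F\<^sub>b" and \<eta> = "vol_density M (\<lambda>\<kappa> p. covec F\<^sub>b \<kappa> p \<bullet> U \<kappa> p)", OF this]
    from cong a show "form_integrable M (vol_density M (\<lambda>\<kappa> p. covec F\<^sub>b \<kappa> p \<bullet> U \<kappa> p)) \<and>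
      form_integrable M (vol_density M (g_inner M F\<^sub>B U)) \<and>
      form_integral M (vol_density M (\<lambda>\<kappa> p. covec F\<^sub>b \<kappa> p \<bullet> U \<kappa> p))
        = form_integral M (vol_density M (g_inner M F\<^sub>B U))" by simp
  qed
qed

text \<open>With \<open>C\<close> the curl of \<open>V\<close>, the chain is \<open>\<omega> \<and>
  d \<eta> = \<omega> \<and> i_C vol = \<omega>(C) vol = g(U, C) vol\<close>.\<close>

lemma wedge_ext_deriv_flat:
  assumes \<omega>: "\<omega> \<in> diff_forms M \<tau> 1" and \<eta>: "\<eta> \<in> diff_forms M \<tau>' 1" and V: "V \<in> vector_fields M \<tau>'"
    and \<omega>U: "\<And>\<kappa> p. \<kappa> \<in> atlas M \<Longrightarrow> p \<in> cdom \<kappa> \<Longrightarrow> covec \<omega> \<kappa> p = metric M \<kappa> p *v U \<kappa> p"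
    and \<eta>V: "\<And>\<kappa> p. \<kappa> \<in> atlas M \<Longrightarrow> p \<in> cdom \<kappa> \<Longrightarrow> covec \<eta> \<kappa> p = metric M \<kappa> p *v V \<kappa> p"
    and \<kappa>: "\<kappa> \<in> atlas M" and p: "p \<in> cdom \<kappa>"
  shows "wedge 1 2 \<omega> (ext_deriv 1 \<eta>) \<kappa> p coordinate_frame
    = vol_density M (g_inner M U (curl M V)) \<kappa> p coordinate_frame"
proof -
  have x: "cmap \<kappa> p \<in> cimg \<kappa>" using p by auto
  have flat: "\<eta> \<kappa> (cinv \<kappa> y) v = flat M V \<kappa> (cinv \<kappa> y) v" if "y \<in> cimg \<kappa>" for y v
    using one_form_covec[OF \<eta> \<kappa> cinv_in_cdom[OF \<kappa> that]] \<eta>V[OF \<kappa> cinv_in_cdom[OF \<kappa> that]]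
    by (simp add: flat_def inner_commute)
  \<comment> \<open>Equality at the single point \<open>p\<close> would not do:
    \<open>\<eta>\<close> and the flat agree on the whole chart image, within which the derivative
    is taken.\<close>
  have "ext_deriv 1 \<eta> \<kappa> p v = ext_deriv 1 (flat M V) \<kappa> p v" for v
    unfolding ext_deriv_def using frechet_derivative_cong_within[OF x flat] by simp
  then have e: "ext_deriv 1 \<eta> \<kappa> p v = int_prod (curl M V) (vol M) \<kappa> p v" for v
    using curl_ext_deriv[OF V \<kappa> p] by simp
  show ?thesis
    using wedge_1_2_vol[where \<omega> = \<omega> and \<eta> = "ext_deriv 1 \<eta>" and \<kappa> = \<kappa> and p = p and u = "covec \<omega> \<kappa> p" and V = "curl M V", OF one_form_covec[OF \<omega> \<kappa> p] e]
    by (simp only: vol_density_def g_inner_def \<omega>U[OF \<kappa> p] metric_symmetric[OF \<kappa> p])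
qed

end

theorem proposition11:
  fixes M :: "'a::{t2_space, second_countable_topology} riemann3"
    and c :: real
    and \<V> :: "('a vfield \<times> 'a vfield) set"
    and F G :: "'a vfield \<Rightarrow> 'a vfield \<Rightarrow> real"
    and F' G' :: "'a dform \<Rightarrow> 'a dform \<Rightarrow> real"
    and D B F\<^sub>D F\<^sub>B G\<^sub>D G\<^sub>B :: "'a vfield"
    and d b F\<^sub>d F\<^sub>b G\<^sub>d G\<^sub>b :: "'a dform"
  assumes "riemannian_3_manifold M"
    and "c > 0"
    and "periodic_bc M \<V> \<or> homogeneous_bc M \<V>"
    and "\<forall>(D, B)\<in>\<V>. F' (int_prod D (vol M)) (int_prod B (vol M)) = F D B"
    and "\<forall>(D, B)\<in>\<V>. G' (int_prod D (vol M)) (int_prod B (vol M)) = G D B"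
    and "(D, B) \<in> \<V>"
    and "d = int_prod D (vol M)"
    and "b = int_prod B (vol M)"
    and "has_vector_fderivs M \<V> F D B F\<^sub>D F\<^sub>B"
    and "has_vector_fderivs M \<V> G D B G\<^sub>D G\<^sub>B"
    and "has_form_fderivs M \<V> F' d b F\<^sub>d F\<^sub>b"
    and "has_form_fderivs M \<V> G' d b G\<^sub>d G\<^sub>b"
    and "form_integrable M (wedge 1 2 F\<^sub>d (ext_deriv 1 G\<^sub>b))"
    and "form_integrable M (wedge 1 2 G\<^sub>d (ext_deriv 1 F\<^sub>b))"
  shows "4 * pi * c * (pairing M 1 F\<^sub>d (ext_deriv 1 G\<^sub>b) - pairing M 1 G\<^sub>d (ext_deriv 1 F\<^sub>b)) =
         4 * pi * c * form_integral M (vol_density M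
           (\<lambda>\<kappa> p. g_inner M F\<^sub>D (curl M G\<^sub>B) \<kappa> p - g_inner M G\<^sub>D (curl M F\<^sub>B) \<kappa> p))"
proof -
  interpret riemannian_manifold3 M by unfold_locales (rule assms(1))
  have V: "F\<^sub>B \<in> vector_fields M Twisted" "G\<^sub>B \<in> vector_fields M Twisted"
    using assms(9,10) unfolding has_vector_fderivs_def by blast+
  have W: "F\<^sub>d \<in> diff_forms M Straight 1" "F\<^sub>b \<in> diff_forms M Twisted 1"
    "G\<^sub>d \<in> diff_forms M Straight 1" "G\<^sub>b \<in> diff_forms M Twisted 1"
    using assms(11,12) unfolding has_form_fderivs_def by blast+
  note F = fderivs_flat[OF assms(3,4,6,9) assms(11)[unfolded assms(7,8)]]
  note G = fderivs_flat[OF assms(3,5,6,10) assms(12)[unfolded assms(7,8)]]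
  let ?\<omega> = "wedge 1 2 F\<^sub>d (ext_deriv 1 G\<^sub>b)" and ?\<eta> = "wedge 1 2 G\<^sub>d (ext_deriv 1 F\<^sub>b)"
  have "vol_density M (\<lambda>\<kappa> p. g_inner M F\<^sub>D (curl M G\<^sub>B) \<kappa> p - g_inner M G\<^sub>D (curl M F\<^sub>B) \<kappa> p) \<kappa> p coordinate_frame
      = ?\<omega> \<kappa> p coordinate_frame - ?\<eta> \<kappa> p coordinate_frame"
    if "\<kappa> \<in> atlas M" "p \<in> cdom \<kappa>" for \<kappa> p
    using wedge_ext_deriv_flat[OF W(1,4) V(2) F(1) G(2) that] wedge_ext_deriv_flat[OF W(3,2) V(1) G(1) F(2) that]
    by (simp add: vol_density_def left_diff_distrib)
  then have "form_integral M (vol_density M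
      (\<lambda>\<kappa> p. g_inner M F\<^sub>D (curl M G\<^sub>B) \<kappa> p - g_inner M G\<^sub>D (curl M F\<^sub>B) \<kappa> p))
    = form_integral M (\<lambda>\<kappa> p v. ?\<omega> \<kappa> p v - ?\<eta> \<kappa> p v)"
    by (rule form_integral_cong)
  \<comment> \<open>The integrability assumptions on the two pairings allow the integral to be
    split.\<close>
  also have "\<dots> = form_integral M ?\<omega> - form_integral M ?\<eta>"
    by (rule form_integral_diff[OF assms(13,14)])
  \<comment> \<open>\<open>pairing\<close> takes its second degree as \<open>3 - k\<close>.\<close>
  moreover have "(3::nat) - 1 = 2" by simp
  ultimately show ?thesis unfolding pairing_def by (simp only:)
qed

end
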